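(* Let $X$ be a set, $\mathcal{C}$ a simplicial complex on $X$, $\mathcal{L}$ a language of regular logic whose variables include $X$, $\vdash$ a regular theory in $\mathcal{L}$, and $([\![-]\!],F)$ an interpretation of $\mathcal{L}$ in a regular category $\mathbf{S}$ that models $\vdash$. Let $\Gamma\subseteq\Phi_{\mathcal{C}}$ and suppose there is a $\mathcal{C}$-finite and inchworm-saturated $\Delta\subseteq\Phi_{\mathcal{C}}$ such that $\Gamma\subseteq\Delta$ and $\Gamma\vdash_{\mathcal{C}}\varphi$ for all $\varphi\in\Delta$. Then $M_F(\Delta)$ is the largest no-signalling subpresheaf of $M_F(\Gamma)$.
   Context: A simplicial complex on $X$ is a family $\mathcal{C}$ of finite subsets of $X$ closed under subsets with $\bigcup\mathcal{C}=X$. $\mathcal{L}$ is a language of regular first-order logic (with $\top$, $\wedge$, $\exists$) whose variables include $X$; each $x\in X$ has a type $T_x$. $\Phi_U$ ($U\subseteq X$) is the set of formulas in context $U$; $\Phi_{\mathcal{C}}=\bigcup_{U\in\mathcal{C}}\Phi_U$; $\Gamma_U=\Gamma\cap\Phi_U$. For $U\subseteq V$ and $\varphi\in\Phi_V$, $\exists_{V\setminus U}.\varphi\in\Phi_U$ quantifies away the variables of $V\setminus U$. $\vdash$ is an entailment relation between sets of formulas and formulas. The inchworm fragment $\vdash_{\mathcal{C}}$ is defined inductively: (i) $\Gamma\vdash_{\mathcal{C}}\varphi$ if some $U\in\mathcal{C}$ has $\varphi\in\Phi_U$ and $\Gamma_U\vdash\varphi$; (ii) if $\Gamma\vdash_{\mathcal{C}}\varphi$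 and $\Delta\cup\{\varphi\}\vdash_{\mathcal{C}}\psi$ then $\Gamma\cup\Delta\vdash_{\mathcal{C}}\psi$. A set $\Gamma\subseteq\Phi_{\mathcal{C}}$ is $\mathcal{C}$-finite if each $\Gamma_U$ ($U\in\mathcal{C}$) is finite, and inchworm-saturated if $\Gamma_V\vdash\varphi$ implies $\Gamma_U\vdash\exists_{V\setminus U}.\varphi$ whenever $U\subseteq V\in\mathcal{C}$ and $\varphi\in\Phi_V$. An interpretation $[\![-]\!]$ of $\mathcal{L}$ in $\mathbf{S}$ gives $F_U=\prod_{x\in U}[\![T_x]\!]$ with projections $F_{U\subseteq V}:F_V\to F_U$ (a sheaf on $\mathcal{C}$), and subobjects $[\![\varphi]\!]_U\rightarrowtail F_U$ for $\varphi\in\Phi_U$. It models $\vdash$ if whenever $\Gamma\vdash\varphi$ some finite $\Delta\subseteq\Gamma$ has $\bigwedge_{\psi\in\Delta}[\![\psi]\!]_U\leqslant[\![\varphi]\!]_U$. For $\mathcal{C}$-finite $\Gamma$, $M_F(\Gamma)$ is the family $M_F(\Gamma)_U=\bigwedge_{\varphi\in\Gamma_U}[\![\varphi]\!]_U\rightarrowtail F_U$, $U\in\mathcal{C}$. A subpresheaf $A$ of $F$ is a family of subobjects $A_U\rightarrowtail F_U$ such that each $F_{U\subseteq V}$ restricts to $A_{U\subseteq V}:A_V\to A_U$; it is no-signalling if every $A_{U\subseteq V}$ is a regular epimorphism; $A\leqslant B$ means $A_U\leqslant B_U$ for all $U$. *)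

theory Defs
  imports Main
begin

section \<open>Regular categories\<close>

record ('o, 'a) category =
  Obj :: "'o set"
  Arr :: "'a set"
  src :: "'a \<Rightarrow> 'o"
  tgt :: "'a \<Rightarrow> 'o"
  ide :: "'o \<Rightarrow> 'a"
  comp :: "'a \<Rightarrow> 'a \<Rightarrow> 'a" (infixr "\<cdot>\<index>" 70)

definition hom :: "('o, 'a, 'm) category_scheme \<Rightarrow> 'o \<Rightarrow> 'o \<Rightarrow> 'a set" where
  "hom S a b = {f \<in> Arr S. src S f = a \<and> tgt S f = b}"

locale category =
  fixes S :: "('o, 'a, 'm) category_scheme" (structure)
  assumes src_Obj: "f \<in> Arr S \<Longrightarrow> src S f \<in> Obj S"
    and tgt_Obj: "f \<in> Arr S \<Longrightarrow> tgt S f \<in> Obj S"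
    and ide_hom: "a \<in> Obj S \<Longrightarrow> ide S a \<in> hom S a a"
    and comp_hom: "f \<in> hom S a b \<Longrightarrow> g \<in> hom S b c \<Longrightarrow> g \<cdot> f \<in> hom S a c"
    and comp_ide: "f \<in> hom S a b \<Longrightarrow> f \<cdot> ide S a = f"
    and ide_comp: "f \<in> hom S a b \<Longrightarrow> ide S b \<cdot> f = f"
    and comp_assoc: "f \<in> hom S a b \<Longrightarrow> g \<in> hom S b c \<Longrightarrow> h \<in> hom S c d
                       \<Longrightarrow> h \<cdot> (g \<cdot> f) = (h \<cdot> g) \<cdot> f"

definition is_mono :: "('o, 'a, 'm) category_scheme \<Rightarrow> 'a \<Rightarrow> bool" where
  "is_mono S m \<longleftrightarrow> m \<in> Arr S \<and>
     (\<forall>a. \<forall>f \<in> hom S a (src S m). \<forall>g \<in> hom S a (src S m).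
        m \<cdot>\<^bsub>S\<^esub> f = m \<cdot>\<^bsub>S\<^esub> g \<longrightarrow> f = g)"

definition is_terminal :: "('o, 'a, 'm) category_scheme \<Rightarrow> 'o \<Rightarrow> bool" where
  "is_terminal S t \<longleftrightarrow> t \<in> Obj S \<and> (\<forall>a \<in> Obj S. \<exists>!f. f \<in> hom S a t)"

definition is_product ::
  "('o, 'a, 'm) category_scheme \<Rightarrow> 'i set \<Rightarrow> ('i \<Rightarrow> 'o) \<Rightarrow> 'o \<Rightarrow> ('i \<Rightarrow> 'a) \<Rightarrow> bool" where
  "is_product S I D P p \<longleftrightarrow> P \<in> Obj S \<and> (\<forall>i \<in> I. p i \<in> hom S P (D i)) \<and>
     (\<forall>a \<in> Obj S. \<forall>q. (\<forall>i \<in> I. q i \<in> hom S a (D i)) \<longrightarrow>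
        (\<exists>!u. u \<in> hom S a P \<and> (\<forall>i \<in> I. p i \<cdot>\<^bsub>S\<^esub> u = q i)))"

text \<open>\<open>p\<close> is the projection to the source of \<open>f\<close>, and \<open>q\<close> the one to the source of \<open>g\<close>;
  so \<open>p\<close> is the pullback of \<open>g\<close> along \<open>f\<close>.\<close>

definition is_pullback ::
  "('o, 'a, 'm) category_scheme \<Rightarrow> 'a \<Rightarrow> 'a \<Rightarrow> 'a \<Rightarrow> 'a \<Rightarrow> bool" where
  "is_pullback S f g p q \<longleftrightarrow>
     f \<in> Arr S \<and> g \<in> Arr S \<and> tgt S f = tgt S g \<and>
     p \<in> hom S (src S p) (src S f) \<and> q \<in> hom S (src S p) (src S g) \<and>
     f \<cdot>\<^bsub>S\<^esub> p = g \<cdot>\<^bsub>S\<^esub> q \<and>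
     (\<forall>a. \<forall>h \<in> hom S a (src S f). \<forall>k \<in> hom S a (src S g).
        f \<cdot>\<^bsub>S\<^esub> h = g \<cdot>\<^bsub>S\<^esub> k \<longrightarrow>
        (\<exists>!u. u \<in> hom S a (src S p) \<and> p \<cdot>\<^bsub>S\<^esub> u = h \<and> q \<cdot>\<^bsub>S\<^esub> u = k))"

definition is_coequalizer ::
  "('o, 'a, 'm) category_scheme \<Rightarrow> 'a \<Rightarrow> 'a \<Rightarrow> 'a \<Rightarrow> bool" where
  "is_coequalizer S f g e \<longleftrightarrow>
     f \<in> Arr S \<and> g \<in> hom S (src S f) (tgt S f) \<and> e \<in> hom S (tgt S f) (tgt S e) \<and>
     e \<cdot>\<^bsub>S\<^esub> f = e \<cdot>\<^bsub>S\<^esub> g \<and>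
     (\<forall>b. \<forall>h \<in> hom S (tgt S f) b. h \<cdot>\<^bsub>S\<^esub> f = h \<cdot>\<^bsub>S\<^esub> g \<longrightarrow>
        (\<exists>!u. u \<in> hom S (tgt S e) b \<and> u \<cdot>\<^bsub>S\<^esub> e = h))"

definition regular_epi :: "('o, 'a, 'm) category_scheme \<Rightarrow> 'a \<Rightarrow> bool" where
  "regular_epi S e \<longleftrightarrow> (\<exists>f g. is_coequalizer S f g e)"

text \<open>Finite limits are given by a terminal object and pullbacks.\<close>

locale regular_category = category +
  assumes has_terminal: "\<exists>t. is_terminal S t"
    and has_pullbacks: "f \<in> Arr S \<Longrightarrow> g \<in> Arr S \<Longrightarrow> tgt S f = tgt S g
                          \<Longrightarrow> \<exists>p q. is_pullback S f g p q"
    and kernel_pair_coequalizer: "is_pullback S f f p q \<Longrightarrow> \<exists>e. is_coequalizer S p q e"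
    and regular_epi_stable: "is_pullback S f g p q \<Longrightarrow> regular_epi S g \<Longrightarrow> regular_epi S p"


section \<open>Subobjects\<close>

text \<open>A subobject is represented by a mono; equality of subobjects is the equivalence
  relation of the preorder \<open>sub_le\<close>. The operations below choose a representative of the
  subobject in question.\<close>

definition Sub :: "('o, 'a, 'm) category_scheme \<Rightarrow> 'o \<Rightarrow> 'a set" where
  "Sub S c = {m. is_mono S m \<and> tgt S m = c}"

definition sub_le :: "('o, 'a, 'm) category_scheme \<Rightarrow> 'a \<Rightarrow> 'a \<Rightarrow> bool" where
  "sub_le S m n \<longleftrightarrow> (\<exists>h \<in> hom S (src S m) (src S n). n \<cdot>\<^bsub>S\<^esub> h = m)"

definition is_meet :: "('o, 'a, 'm) category_scheme \<Rightarrow> 'o \<Rightarrow> 'a set \<Rightarrow> 'a \<Rightarrow> bool" where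
  "is_meet S c P m \<longleftrightarrow> m \<in> Sub S c \<and> (\<forall>n \<in> P. sub_le S m n) \<and>
     (\<forall>k \<in> Sub S c. (\<forall>n \<in> P. sub_le S k n) \<longrightarrow> sub_le S k m)"

definition meet :: "('o, 'a, 'm) category_scheme \<Rightarrow> 'o \<Rightarrow> 'a set \<Rightarrow> 'a" where
  "meet S c P = (SOME m. is_meet S c P m)"

definition inverse_image :: "('o, 'a, 'm) category_scheme \<Rightarrow> 'a \<Rightarrow> 'a \<Rightarrow> 'a" where
  "inverse_image S f n = (SOME p. \<exists>q. is_pullback S f n p q)"

definition direct_image :: "('o, 'a, 'm) category_scheme \<Rightarrow> 'a \<Rightarrow> 'a \<Rightarrow> 'a" where
  "direct_image S f m = (SOME n. n \<in> Sub S (tgt S f) \<and>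
     (\<exists>e \<in> hom S (src S m) (src S n). regular_epi S e \<and> n \<cdot>\<^bsub>S\<^esub> e = f \<cdot>\<^bsub>S\<^esub> m))"


section \<open>Languages of regular logic\<close>

datatype ('f, tm_vars: 'v) tm = Var 'v | Fn 'f "('f, 'v) tm list"

text \<open>There is no built-in equality: an equality predicate is a relation symbol whose
  equality rules belong to the theory and which is interpreted by the diagonal.\<close>

datatype ('f, 'r, 'v) fm =
    Rel 'r "('f, 'v) tm list"
  | Top
  | And "('f, 'r, 'v) fm" "('f, 'r, 'v) fm"
  | Ex 'v "('f, 'r, 'v) fm"

text \<open>The carriers \<open>Vars\<close>, \<open>Funs\<close> and \<open>Rels\<close> are sets because HOL types are nonempty.
  Superfluous elements of the type \<open>'s\<close> of sorts are harmless.\<close>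

record ('s, 'f, 'r, 'v) language =
  Vars :: "'v set"
  Funs :: "'f set"
  Rels :: "'r set"
  var_sort :: "'v \<Rightarrow> 's"
  fun_args :: "'f \<Rightarrow> 's list"
  fun_res :: "'f \<Rightarrow> 's"
  rel_args :: "'r \<Rightarrow> 's list"

inductive has_sort ::
  "('s, 'f, 'r, 'v, 'm) language_scheme \<Rightarrow> 'v set \<Rightarrow> ('f, 'v) tm \<Rightarrow> 's \<Rightarrow> bool"
  for L :: "('s, 'f, 'r, 'v, 'm) language_scheme" and U :: "'v set" where
  Var: "x \<in> U \<Longrightarrow> x \<in> Vars L \<Longrightarrow> has_sort L U (Var x) (var_sort L x)"
| Fn: "f \<in> Funs L \<Longrightarrow> list_all2 (has_sort L U) ts (fun_args L f)
         \<Longrightarrow> has_sort L U (Fn f ts) (fun_res L f)"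

primrec in_context ::
  "('s, 'f, 'r, 'v, 'm) language_scheme \<Rightarrow> 'v set \<Rightarrow> ('f, 'r, 'v) fm \<Rightarrow> bool" where
  "in_context L U (Rel r ts) \<longleftrightarrow> r \<in> Rels L \<and> list_all2 (has_sort L U) ts (rel_args L r)"
| "in_context L U Top \<longleftrightarrow> True"
| "in_context L U (And \<phi> \<psi>) \<longleftrightarrow> in_context L U \<phi> \<and> in_context L U \<psi>"
| "in_context L U (Ex x \<phi>) \<longleftrightarrow> x \<in> Vars L \<and> in_context L (insert x U) \<phi>"

definition Fm :: "('s, 'f, 'r, 'v, 'm) language_scheme \<Rightarrow> 'v set \<Rightarrow> ('f, 'r, 'v) fm set" where
  "Fm L U = {\<phi>. in_context L U \<phi>}"

definition Fm_of :: "('s, 'f, 'r, 'v, 'm) language_scheme \<Rightarrow> 'v set set \<Rightarrow> ('f, 'r, 'v) fm set" where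
  "Fm_of L \<C> = (\<Union>U \<in> \<C>. Fm L U)"

text \<open>Quantification over a finite set of variables, in an arbitrarily chosen order.\<close>

definition Exs :: "'v set \<Rightarrow> ('f, 'r, 'v) fm \<Rightarrow> ('f, 'r, 'v) fm" where
  "Exs W \<phi> = foldr Ex (SOME xs. distinct xs \<and> set xs = W) \<phi>"

primrec free_vars :: "('f, 'r, 'v) fm \<Rightarrow> 'v set" where
  "free_vars (Rel r ts) = (\<Union>t \<in> set ts. tm_vars t)"
| "free_vars Top = {}"
| "free_vars (And \<phi> \<psi>) = free_vars \<phi> \<union> free_vars \<psi>"
| "free_vars (Ex x \<phi>) = free_vars \<phi> - {x}"

primrec tm_subst :: "('v \<Rightarrow> ('f, 'v) tm) \<Rightarrow> ('f, 'v) tm \<Rightarrow> ('f, 'v) tm" where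
  "tm_subst \<sigma> (Var x) = \<sigma> x"
| "tm_subst \<sigma> (Fn f ts) = Fn f (map (tm_subst \<sigma>) ts)"

text \<open>\<open>subst\<close> does not rename bound variables; it is the intended substitution
  if \<open>free_for\<close> holds, which says that no variable is captured.\<close>

primrec subst :: "('v \<Rightarrow> ('f, 'v) tm) \<Rightarrow> ('f, 'r, 'v) fm \<Rightarrow> ('f, 'r, 'v) fm" where
  "subst \<sigma> (Rel r ts) = Rel r (map (tm_subst \<sigma>) ts)"
| "subst \<sigma> Top = Top"
| "subst \<sigma> (And \<phi> \<psi>) = And (subst \<sigma> \<phi>) (subst \<sigma> \<psi>)"
| "subst \<sigma> (Ex x \<phi>) = Ex x (subst (\<sigma>(x := Var x)) \<phi>)"

primrec free_for :: "('v \<Rightarrow> ('f, 'v) tm) \<Rightarrow> ('f, 'r, 'v) fm \<Rightarrow> bool" where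
  "free_for \<sigma> (Rel r ts) \<longleftrightarrow> True"
| "free_for \<sigma> Top \<longleftrightarrow> True"
| "free_for \<sigma> (And \<phi> \<psi>) \<longleftrightarrow> free_for \<sigma> \<phi> \<and> free_for \<sigma> \<psi>"
| "free_for \<sigma> (Ex x \<phi>) \<longleftrightarrow>
     (\<forall>y \<in> free_vars \<phi> - {x}. x \<notin> tm_vars (\<sigma> y)) \<and> free_for (\<sigma>(x := Var x)) \<phi>"


section \<open>Regular theories\<close>

text \<open>Sequents are sequents in context: \<open>ent U \<Gamma> \<phi>\<close> is the entailment of \<open>\<phi>\<close> by \<open>\<Gamma>\<close> among
  the formulas in context \<open>U\<close>. An entailment that ignores contexts would derive
  \<open>Ex x Top\<close> in the empty context, which fails if the sort of \<open>x\<close> is interpreted by an object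
  without global support. A context-free entailment \<open>R\<close> is the special case
  in which \<open>ent U \<Gamma> \<phi>\<close> holds iff \<open>U\<close> is a finite set of variables,
  \<open>\<Gamma> \<union> {\<phi>} \<subseteq> Fm L U\<close> and \<open>R \<Gamma> \<phi>\<close>.\<close>

locale regular_theory =
  fixes L :: "('s, 'f, 'r, 'v, 'm) language_scheme"
    and ent :: "'v set \<Rightarrow> ('f, 'r, 'v) fm set \<Rightarrow> ('f, 'r, 'v) fm \<Rightarrow> bool"
  assumes sequent: "ent U \<Gamma> \<phi> \<Longrightarrow> finite U \<and> U \<subseteq> Vars L \<and> \<Gamma> \<subseteq> Fm L U \<and> \<phi> \<in> Fm L U"
    and assumption: "finite U \<Longrightarrow> U \<subseteq> Vars L \<Longrightarrow> \<Gamma> \<subseteq> Fm L U \<Longrightarrow> \<phi> \<in> \<Gamma> \<Longrightarrow> ent U \<Gamma> \<phi>"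
    and weakening: "ent U \<Gamma> \<phi> \<Longrightarrow> \<Gamma> \<subseteq> \<Delta> \<Longrightarrow> \<Delta> \<subseteq> Fm L U \<Longrightarrow> ent U \<Delta> \<phi>"
    and cut: "ent U \<Gamma> \<phi> \<Longrightarrow> ent U (\<Delta> \<union> {\<phi>}) \<psi> \<Longrightarrow> ent U (\<Gamma> \<union> \<Delta>) \<psi>"
    and substitution:
      "ent U \<Gamma> \<phi> \<Longrightarrow> finite V \<Longrightarrow> V \<subseteq> Vars L
         \<Longrightarrow> (\<And>x. x \<in> U \<Longrightarrow> has_sort L V (\<sigma> x) (var_sort L x))
         \<Longrightarrow> (\<And>\<psi>. \<psi> \<in> \<Gamma> \<union> {\<phi>} \<Longrightarrow> free_for \<sigma> \<psi>)
         \<Longrightarrow> ent V (subst \<sigma> ` \<Gamma>) (subst \<sigma> \<phi>)"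
    and Top: "finite U \<Longrightarrow> U \<subseteq> Vars L \<Longrightarrow> \<Gamma> \<subseteq> Fm L U \<Longrightarrow> ent U \<Gamma> Top"
    and And: "ent U \<Gamma> (And \<phi> \<psi>) \<longleftrightarrow> ent U \<Gamma> \<phi> \<and> ent U \<Gamma> \<psi>"
    and Ex: "x \<in> Vars L \<Longrightarrow> x \<notin> U \<Longrightarrow> \<Gamma> \<subseteq> Fm L U \<Longrightarrow> \<psi> \<in> Fm L U
         \<Longrightarrow> ent U (\<Gamma> \<union> {Ex x \<phi>}) \<psi> \<longleftrightarrow> ent (insert x U) (\<Gamma> \<union> {\<phi>}) \<psi>"


section \<open>Interpretations\<close>

text \<open>\<open>ctx U\<close> with the projections \<open>ctx_pr U\<close> is the product \<open>F\<^sub>U\<close>; \<open>args ss\<close> with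
  \<open>args_pr ss\<close> is the product of a list of sorts, used for the arguments of symbols.
  The bound variables of a formula may lie outside the set \<open>X\<close>, so contexts range over all
  finite sets of variables of the language.\<close>

record ('s, 'f, 'r, 'v, 'o, 'a) interp =
  sort_obj :: "'s \<Rightarrow> 'o"
  ctx :: "'v set \<Rightarrow> 'o"
  ctx_pr :: "'v set \<Rightarrow> 'v \<Rightarrow> 'a"
  args :: "'s list \<Rightarrow> 'o"
  args_pr :: "'s list \<Rightarrow> nat \<Rightarrow> 'a"
  fun_arr :: "'f \<Rightarrow> 'a"
  rel_sub :: "'r \<Rightarrow> 'a"

locale regular_interpretation =
  fixes S :: "('o, 'a, 'm) category_scheme"
    and L :: "('s, 'f, 'r, 'v, 'n) language_scheme"
    and I :: "('s, 'f, 'r, 'v, 'o, 'a, 'p) interp_scheme"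
  assumes sort_obj: "sort_obj I s \<in> Obj S"
    and ctx_product: "finite U \<Longrightarrow> U \<subseteq> Vars L
          \<Longrightarrow> is_product S U (\<lambda>x. sort_obj I (var_sort L x)) (ctx I U) (ctx_pr I U)"
    and args_product:
          "is_product S {..<length ss} (\<lambda>i. sort_obj I (ss ! i)) (args I ss) (args_pr I ss)"
    and fun_arr: "f \<in> Funs L
          \<Longrightarrow> fun_arr I f \<in> hom S (args I (fun_args L f)) (sort_obj I (fun_res L f))"
    and rel_sub: "r \<in> Rels L \<Longrightarrow> rel_sub I r \<in> Sub S (args I (rel_args L r))"

text \<open>\<open>proj S I U V\<close> is \<open>F\<^bsub>U\<subseteq>V\<^esub> : F\<^sub>V \<rightarrow> F\<^sub>U\<close>.\<close>

definition proj ::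
  "('o, 'a, 'm) category_scheme \<Rightarrow> ('s, 'f, 'r, 'v, 'o, 'a, 'p) interp_scheme
     \<Rightarrow> 'v set \<Rightarrow> 'v set \<Rightarrow> 'a" where
  "proj S I U V = (THE u. u \<in> hom S (ctx I V) (ctx I U) \<and>
     (\<forall>x \<in> U. ctx_pr I U x \<cdot>\<^bsub>S\<^esub> u = ctx_pr I V x))"

definition tuple ::
  "('o, 'a, 'm) category_scheme \<Rightarrow> ('s, 'f, 'r, 'v, 'o, 'a, 'p) interp_scheme
     \<Rightarrow> 'v set \<Rightarrow> 's list \<Rightarrow> 'a list \<Rightarrow> 'a" where
  "tuple S I U ss hs = (THE u. u \<in> hom S (ctx I U) (args I ss) \<and>
     (\<forall>i < length ss. args_pr I ss i \<cdot>\<^bsub>S\<^esub> u = hs ! i))"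

primrec tm_arr ::
  "('o, 'a, 'm) category_scheme \<Rightarrow> ('s, 'f, 'r, 'v, 'n) language_scheme
     \<Rightarrow> ('s, 'f, 'r, 'v, 'o, 'a, 'p) interp_scheme \<Rightarrow> 'v set \<Rightarrow> ('f, 'v) tm \<Rightarrow> 'a" where
  "tm_arr S L I U (Var x) = ctx_pr I U x"
| "tm_arr S L I U (Fn f ts) =
     fun_arr I f \<cdot>\<^bsub>S\<^esub> tuple S I U (fun_args L f) (map (tm_arr S L I U) ts)"

text \<open>If \<open>x \<notin> U\<close>, the clause for \<open>Ex\<close> is the direct image along
  \<open>F\<^bsub>U \<union> {x}\<^esub> \<rightarrow> F\<^sub>U\<close>, pulled back along an identity. If \<open>x \<in> U\<close>, then \<open>Ex x \<phi>\<close>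
  lies in context \<open>U - {x}\<close> and is pulled back from there, so that the bound
  occurrences are not confused with the \<open>x\<close> of the context.\<close>

primrec fm_sub ::
  "('o, 'a, 'm) category_scheme \<Rightarrow> ('s, 'f, 'r, 'v, 'n) language_scheme
     \<Rightarrow> ('s, 'f, 'r, 'v, 'o, 'a, 'p) interp_scheme \<Rightarrow> 'v set \<Rightarrow> ('f, 'r, 'v) fm \<Rightarrow> 'a" where
  "fm_sub S L I U (Rel r ts) =
     inverse_image S (tuple S I U (rel_args L r) (map (tm_arr S L I U) ts)) (rel_sub I r)"
| "fm_sub S L I U Top = ide S (ctx I U)"
| "fm_sub S L I U (And \<phi> \<psi>) = meet S (ctx I U) {fm_sub S L I U \<phi>, fm_sub S L I U \<psi>}"
| "fm_sub S L I U (Ex x \<phi>) =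
     inverse_image S (proj S I (U - {x}) U)
       (direct_image S (proj S I (U - {x}) (insert x U)) (fm_sub S L I (insert x U) \<phi>))"

definition models ::
  "('o, 'a, 'm) category_scheme \<Rightarrow> ('s, 'f, 'r, 'v, 'n) language_scheme
     \<Rightarrow> ('s, 'f, 'r, 'v, 'o, 'a, 'p) interp_scheme \<Rightarrow> 'v set
     \<Rightarrow> ('v set \<Rightarrow> ('f, 'r, 'v) fm set \<Rightarrow> ('f, 'r, 'v) fm \<Rightarrow> bool) \<Rightarrow> bool" where
  "models S L I X ent \<longleftrightarrow> (\<forall>U \<Gamma> \<phi>. U \<subseteq> X \<longrightarrow> ent U \<Gamma> \<phi> \<longrightarrow>
     (\<exists>\<Delta> \<subseteq> \<Gamma>. finite \<Delta> \<and>
        sub_le S (meet S (ctx I U) (fm_sub S L I U ` \<Delta>)) (fm_sub S L I U \<phi>)))"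


section \<open>The inchworm fragment\<close>

definition simplicial_complex :: "'v set \<Rightarrow> 'v set set \<Rightarrow> bool" where
  "simplicial_complex X \<C> \<longleftrightarrow> (\<forall>U \<in> \<C>. finite U) \<and>
     (\<forall>U \<in> \<C>. \<forall>V. V \<subseteq> U \<longrightarrow> V \<in> \<C>) \<and> \<Union>\<C> = X"

inductive inchworm ::
  "('s, 'f, 'r, 'v, 'm) language_scheme
     \<Rightarrow> ('v set \<Rightarrow> ('f, 'r, 'v) fm set \<Rightarrow> ('f, 'r, 'v) fm \<Rightarrow> bool) \<Rightarrow> 'v set set
     \<Rightarrow> ('f, 'r, 'v) fm set \<Rightarrow> ('f, 'r, 'v) fm \<Rightarrow> bool"
  for L :: "('s, 'f, 'r, 'v, 'm) language_scheme"
    and ent :: "'v set \<Rightarrow> ('f, 'r, 'v) fm set \<Rightarrow> ('f, 'r, 'v) fm \<Rightarrow> bool"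
    and \<C> :: "'v set set" where
  local: "U \<in> \<C> \<Longrightarrow> \<phi> \<in> Fm L U \<Longrightarrow> ent U (\<Gamma> \<inter> Fm L U) \<phi> \<Longrightarrow> inchworm L ent \<C> \<Gamma> \<phi>"
| cut: "inchworm L ent \<C> \<Gamma> \<phi> \<Longrightarrow> inchworm L ent \<C> (\<Delta> \<union> {\<phi>}) \<psi>
          \<Longrightarrow> inchworm L ent \<C> (\<Gamma> \<union> \<Delta>) \<psi>"

definition C_finite ::
  "('s, 'f, 'r, 'v, 'm) language_scheme \<Rightarrow> 'v set set \<Rightarrow> ('f, 'r, 'v) fm set \<Rightarrow> bool" where
  "C_finite L \<C> \<Gamma> \<longleftrightarrow> (\<forall>U \<in> \<C>. finite (\<Gamma> \<inter> Fm L U))"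

definition inchworm_saturated ::
  "('s, 'f, 'r, 'v, 'm) language_scheme
     \<Rightarrow> ('v set \<Rightarrow> ('f, 'r, 'v) fm set \<Rightarrow> ('f, 'r, 'v) fm \<Rightarrow> bool) \<Rightarrow> 'v set set
     \<Rightarrow> ('f, 'r, 'v) fm set \<Rightarrow> bool" where
  "inchworm_saturated L ent \<C> \<Gamma> \<longleftrightarrow>
     (\<forall>U V \<phi>. U \<subseteq> V \<longrightarrow> V \<in> \<C> \<longrightarrow> \<phi> \<in> Fm L V \<longrightarrow> ent V (\<Gamma> \<inter> Fm L V) \<phi>
        \<longrightarrow> ent U (\<Gamma> \<inter> Fm L U) (Exs (V - U) \<phi>))"


section \<open>Subpresheaves\<close>

text \<open>Families of subobjects are functions on sets of variables, of which only the values on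
  the complex matter.\<close>

definition model_family ::
  "('o, 'a, 'm) category_scheme \<Rightarrow> ('s, 'f, 'r, 'v, 'n) language_scheme
     \<Rightarrow> ('s, 'f, 'r, 'v, 'o, 'a, 'p) interp_scheme \<Rightarrow> ('f, 'r, 'v) fm set \<Rightarrow> 'v set \<Rightarrow> 'a" where
  "model_family S L I \<Gamma> U = meet S (ctx I U) (fm_sub S L I U ` (\<Gamma> \<inter> Fm L U))"

text \<open>\<open>h\<close> is the restriction \<open>A\<^bsub>U\<subseteq>V\<^esub>\<close> of \<open>F\<^bsub>U\<subseteq>V\<^esub>\<close>; it is unique since \<open>A U\<close> is mono.\<close>

definition restricts_to ::
  "('o, 'a, 'm) category_scheme \<Rightarrow> ('s, 'f, 'r, 'v, 'o, 'a, 'p) interp_scheme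
     \<Rightarrow> ('v set \<Rightarrow> 'a) \<Rightarrow> 'v set \<Rightarrow> 'v set \<Rightarrow> 'a \<Rightarrow> bool" where
  "restricts_to S I A U V h \<longleftrightarrow> h \<in> hom S (src S (A V)) (src S (A U)) \<and>
     A U \<cdot>\<^bsub>S\<^esub> h = proj S I U V \<cdot>\<^bsub>S\<^esub> A V"

definition subpresheaf ::
  "('o, 'a, 'm) category_scheme \<Rightarrow> ('s, 'f, 'r, 'v, 'o, 'a, 'p) interp_scheme
     \<Rightarrow> 'v set set \<Rightarrow> ('v set \<Rightarrow> 'a) \<Rightarrow> bool" where
  "subpresheaf S I \<C> A \<longleftrightarrow> (\<forall>U \<in> \<C>. A U \<in> Sub S (ctx I U)) \<and>
     (\<forall>V \<in> \<C>. \<forall>U. U \<subseteq> V \<longrightarrow> (\<exists>h. restricts_to S I A U V h))"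

definition no_signalling ::
  "('o, 'a, 'm) category_scheme \<Rightarrow> ('s, 'f, 'r, 'v, 'o, 'a, 'p) interp_scheme
     \<Rightarrow> 'v set set \<Rightarrow> ('v set \<Rightarrow> 'a) \<Rightarrow> bool" where
  "no_signalling S I \<C> A \<longleftrightarrow> subpresheaf S I \<C> A \<and>
     (\<forall>V \<in> \<C>. \<forall>U. U \<subseteq> V \<longrightarrow> (\<forall>h. restricts_to S I A U V h \<longrightarrow> regular_epi S h))"

definition family_le ::
  "('o, 'a, 'm) category_scheme \<Rightarrow> 'v set set \<Rightarrow> ('v set \<Rightarrow> 'a) \<Rightarrow> ('v set \<Rightarrow> 'a) \<Rightarrow> bool" where
  "family_le S \<C> A B \<longleftrightarrow> (\<forall>U \<in> \<C>. sub_le S (A U) (B U))"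

definition largest_no_signalling_in ::
  "('o, 'a, 'm) category_scheme \<Rightarrow> ('s, 'f, 'r, 'v, 'o, 'a, 'p) interp_scheme
     \<Rightarrow> 'v set set \<Rightarrow> ('v set \<Rightarrow> 'a) \<Rightarrow> ('v set \<Rightarrow> 'a) \<Rightarrow> bool" where
  "largest_no_signalling_in S I \<C> M A \<longleftrightarrow>
     no_signalling S I \<C> A \<and> family_le S \<C> A M \<and>
     (\<forall>B. no_signalling S I \<C> B \<longrightarrow> family_le S \<C> B M \<longrightarrow> family_le S \<C> B A)"

end

theory Submission
  imports Defs
begin

text \<open>Subobjects are compared through generalized elements, as in Kripke-Joyal semantics:
  inverse images and meets are computed elementwise, and an element belongs to a direct image
  iff it lifts after composition with a regular epimorphism; such a cover can be
  dropped because regular epimorphisms are orthogonal to monomorphisms. In these terms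
  the interpretation of a formula is stable under enlarging the context.

  \<open>M(\<Delta>)\<close> is no-signalling because saturation puts \<open>M(\<Delta>)\<^sub>U\<close> below the image of
  \<open>M(\<Delta>)\<^sub>V\<close>. It is the largest because the inchworm rules are sound for a
  no-signalling \<open>B\<close>: if \<open>B\<^sub>U \<le> \<lbrakk>\<phi>\<rbrakk>\<^sub>U\<close> and \<open>\<phi>\<close> is also in context \<open>V\<close>, then it is in
  context \<open>U \<inter> V\<close>, the inequality descends along the cover
  \<open>B\<^sub>U \<rightarrow> B\<^bsub>U \<inter> V\<^esub>\<close>, and it restricts to \<open>B\<^sub>V\<close>.\<close>

section \<open>Generalized elements of subobjects\<close>

lemma (in category) comp_cong_left:
  assumes "f \<cdot> g = h" "g \<in> hom S a b" "f \<in> hom S b c" "k \<in> hom S d a"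
  shows "f \<cdot> (g \<cdot> k) = h \<cdot> k"
  using comp_assoc[OF assms(4,2,3)] assms(1) by simp

lemma homD: "f \<in> hom S a b \<Longrightarrow> f \<in> Arr S \<and> src S f = a \<and> tgt S f = b"
  by (simp add: hom_def)

lemma (in category) hom_Obj: "f \<in> hom S a b \<Longrightarrow> a \<in> Obj S \<and> b \<in> Obj S"
  using src_Obj tgt_Obj by (auto simp: hom_def)

lemma Sub_hom: "m \<in> Sub S c \<Longrightarrow> m \<in> hom S (src S m) c"
  by (simp add: Sub_def is_mono_def hom_def)

lemma Sub_cancel:
  "m \<in> Sub S c \<Longrightarrow> f \<in> hom S a (src S m) \<Longrightarrow> g \<in> hom S a (src S m)
     \<Longrightarrow> m \<cdot>\<^bsub>S\<^esub> f = m \<cdot>\<^bsub>S\<^esub> g \<Longrightarrow> f = g"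
  by (auto simp: Sub_def is_mono_def)

lemma Sub_intro:
  assumes "m \<in> hom S b c"
    and "\<And>a f g. f \<in> hom S a b \<Longrightarrow> g \<in> hom S a b \<Longrightarrow> m \<cdot>\<^bsub>S\<^esub> f = m \<cdot>\<^bsub>S\<^esub> g \<Longrightarrow> f = g"
  shows "m \<in> Sub S c"
  using assms by (auto simp: Sub_def is_mono_def hom_def)

text \<open>In the following, the left argument of \<^const>\<open>sub_le\<close> may be an arbitrary arrow \<open>y\<close>:
  then \<open>sub_le S y n\<close> says that \<open>y\<close>, as a generalized element of its target, belongs
  to the subobject \<open>n\<close>.\<close>

lemma sub_leE:
  assumes "sub_le S y n" "y \<in> hom S t c"
  obtains h where "h \<in> hom S t (src S n)" "n \<cdot>\<^bsub>S\<^esub> h = y"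
  using assms by (auto simp: sub_le_def hom_def)

lemma sub_leI: "y \<in> hom S t c \<Longrightarrow> h \<in> hom S t (src S n) \<Longrightarrow> n \<cdot>\<^bsub>S\<^esub> h = y \<Longrightarrow> sub_le S y n"
  by (auto simp: sub_le_def hom_def)

section \<open>Membership, covers and pullbacks in a category\<close>

context category
begin

lemma sub_le_comp:
  assumes "n \<in> Sub S c" "y \<in> hom S t c" "sub_le S y n" "u \<in> hom S s t"
  shows "sub_le S (y \<cdot> u) n"
proof -
  obtain h where h: "h \<in> hom S t (src S n)" "n \<cdot> h = y"
    using sub_leE assms(2,3) by metis
  show ?thesis
    by (rule sub_leI[OF comp_hom[OF assms(4,2)] comp_hom[OF assms(4) h(1)]])
      (rule comp_cong_left[OF h(2,1) Sub_hom[OF assms(1)] assms(4)])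
qed

lemma sub_le_trans:
  assumes "m \<in> Sub S c" "n \<in> Sub S c" "y \<in> hom S t c" "sub_le S y m" "sub_le S m n"
  shows "sub_le S y n"
proof -
  obtain h where h: "h \<in> hom S t (src S m)" "m \<cdot> h = y"
    using sub_leE assms(3,4) by metis
  show ?thesis
    using sub_le_comp[OF assms(2) Sub_hom[OF assms(1)] assms(5) h(1)] h(2) by simp
qed

lemma sub_le_refl: "m \<in> Sub S c \<Longrightarrow> sub_le S m m"
  using sub_leI[OF Sub_hom] ide_hom comp_ide Sub_hom hom_Obj by metis

lemma ide_Sub: "c \<in> Obj S \<Longrightarrow> ide S c \<in> Sub S c"
  by (rule Sub_intro[OF ide_hom]) (auto simp: ide_comp)

lemma sub_le_ide: "y \<in> hom S t c \<Longrightarrow> sub_le S y (ide S c)"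
  using sub_leI[of y S t c y "ide S c"] ide_comp ide_hom hom_Obj homD by metis

lemma regular_epiE:
  assumes "regular_epi S e" "e \<in> hom S b c"
  obtains r f g where "f \<in> hom S r b" "g \<in> hom S r b" "e \<cdot> f = e \<cdot> g"
    "\<forall>d. \<forall>h \<in> hom S b d. h \<cdot> f = h \<cdot> g \<longrightarrow> (\<exists>!u. u \<in> hom S c d \<and> u \<cdot> e = h)"
proof -
  obtain f g where fg: "is_coequalizer S f g e"
    using assms(1) by (auto simp: regular_epi_def)
  have t: "tgt S f = b" "tgt S e = c" "src S e = b"
    using fg assms(2) by (auto simp: is_coequalizer_def hom_def)
  show thesis
    by (rule that[of f "src S f" g])
      (use fg t in \<open>auto simp: is_coequalizer_def hom_def\<close>)
qed

lemma regular_epi_cancel: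
  assumes "regular_epi S e" "e \<in> hom S b c" "h \<in> hom S c d" "k \<in> hom S c d" "h \<cdot> e = k \<cdot> e"
  shows "h = k"
proof -
  obtain r f g where f: "f \<in> hom S r b" "g \<in> hom S r b" "e \<cdot> f = e \<cdot> g"
    and u: "\<forall>d. \<forall>h \<in> hom S b d. h \<cdot> f = h \<cdot> g \<longrightarrow> (\<exists>!u. u \<in> hom S c d \<and> u \<cdot> e = h)"
    by (rule regular_epiE[OF assms(1,2)])
  have "(h \<cdot> e) \<cdot> f = (h \<cdot> e) \<cdot> g"
    using comp_assoc[OF f(1) assms(2,3)] comp_assoc[OF f(2) assms(2,3)] f(3) by simp
  with u comp_hom[OF assms(2,3)] have "\<exists>!u. u \<in> hom S c d \<and> u \<cdot> e = h \<cdot> e"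
    by blast
  then show ?thesis using assms(3,4,5) by metis
qed

text \<open>The lift \<open>h\<close> of \<open>y \<cdot> e\<close> through \<open>n\<close>
  identifies the parallel pair whose coequalizer is \<open>e\<close>, because
  \<open>y \<cdot> e\<close> does and \<open>n\<close> is mono. Hence \<open>h\<close> descends
  along \<open>e\<close>, and the descended arrow is a lift of \<open>y\<close> because
  \<open>e\<close> is epic.\<close>

lemma sub_le_cover:
  assumes "n \<in> Sub S c" "y \<in> hom S t c" "regular_epi S e" "e \<in> hom S s t"
    and "sub_le S (y \<cdot> e) n"
  shows "sub_le S y n"
proof -
  note n = Sub_hom[OF assms(1)]
  obtain h where h: "h \<in> hom S s (src S n)" "n \<cdot> h = y \<cdot> e"
    using sub_leE[OF assms(5) comp_hom[OF assms(4,2)]] by metis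
  obtain r f g where f: "f \<in> hom S r s" "g \<in> hom S r s" "e \<cdot> f = e \<cdot> g"
    and u: "\<forall>d. \<forall>h \<in> hom S s d. h \<cdot> f = h \<cdot> g \<longrightarrow> (\<exists>!u. u \<in> hom S t d \<and> u \<cdot> e = h)"
    by (rule regular_epiE[OF assms(3,4)])
  have "n \<cdot> (h \<cdot> f) = n \<cdot> (h \<cdot> g)"
    using comp_assoc[OF f(1) h(1) n] comp_assoc[OF f(2) h(1) n] h(2)
      comp_assoc[OF f(1) assms(4,2)] comp_assoc[OF f(2) assms(4,2)] f(3) by simp
  then have "h \<cdot> f = h \<cdot> g"
    using Sub_cancel[OF assms(1) comp_hom[OF f(1) h(1)] comp_hom[OF f(2) h(1)]] by simp
  then obtain v where v: "v \<in> hom S t (src S n)" "v \<cdot> e = h"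
    using u h(1) by blast
  have "(n \<cdot> v) \<cdot> e = y \<cdot> e"
    using comp_assoc[OF assms(4) v(1) n] v(2) h(2) by simp
  then have "n \<cdot> v = y"
    using regular_epi_cancel[OF assms(3,4) comp_hom[OF v(1) n] assms(2)] by simp
  then show ?thesis using sub_leI[OF assms(2) v(1)] by simp
qed

text \<open>The cover \<open>k \<cdot> h\<close> factors through \<open>k\<close>, so by
  \<open>sub_le_cover\<close> the identity of \<open>c\<close> does too. The resulting section
  \<open>s\<close> makes the mono \<open>k\<close> an isomorphism, and \<open>h\<close> becomes a
  coequalizer of the same pair as \<open>k \<cdot> h\<close>.\<close>

lemma regular_epi_factor:
  assumes "k \<in> Sub S c" "h \<in> hom S a (src S k)" "regular_epi S (k \<cdot> h)"
  shows "regular_epi S h"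
proof -
  note k = Sub_hom[OF assms(1)]
  note e = comp_hom[OF assms(2) k]
  let ?b = "src S k"
  have c: "c \<in> Obj S" and b: "?b \<in> Obj S" using hom_Obj[OF k] by auto
  have "sub_le S (ide S c \<cdot> (k \<cdot> h)) k"
    using sub_leI[OF e assms(2)] ide_comp[OF e] by simp
  then have "sub_le S (ide S c) k"
    using sub_le_cover[OF assms(1) ide_hom[OF c] assms(3) e] by simp
  then obtain s where s: "s \<in> hom S c ?b" "k \<cdot> s = ide S c"
    using sub_leE[OF _ ide_hom[OF c]] by metis
  have "k \<cdot> (s \<cdot> k) = k \<cdot> ide S ?b"
    using comp_cong_left[OF s(2,1) k k] ide_comp[OF k] comp_ide[OF k] by simp
  then have sk: "s \<cdot> k = ide S ?b"
    using Sub_cancel[OF assms(1) comp_hom[OF k s(1)] ide_hom[OF b]] by simp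
  obtain f g where fg: "is_coequalizer S f g (k \<cdot> h)"
    using assms(3) by (auto simp: regular_epi_def)
  have tf: "tgt S f = a" "tgt S (k \<cdot> h) = c" "src S (k \<cdot> h) = a"
    using fg e by (auto simp: is_coequalizer_def hom_def)
  have f: "f \<in> hom S (src S f) a" "g \<in> hom S (src S f) a" "(k \<cdot> h) \<cdot> f = (k \<cdot> h) \<cdot> g"
    and u: "\<And>d w. w \<in> hom S a d \<Longrightarrow> w \<cdot> f = w \<cdot> g \<Longrightarrow> \<exists>!u. u \<in> hom S c d \<and> u \<cdot> (k \<cdot> h) = w"
    using fg tf by (auto simp: is_coequalizer_def hom_def)
  have "k \<cdot> (h \<cdot> f) = k \<cdot> (h \<cdot> g)"
    using comp_assoc[OF f(1) assms(2) k] comp_assoc[OF f(2) assms(2) k] f(3) by simp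
  then have eq: "h \<cdot> f = h \<cdot> g"
    using Sub_cancel[OF assms(1) comp_hom[OF f(1) assms(2)] comp_hom[OF f(2) assms(2)]] by simp
  have ex: "\<exists>!v. v \<in> hom S ?b d \<and> v \<cdot> h = w" if w: "w \<in> hom S a d" "w \<cdot> f = w \<cdot> g" for d w
  proof -
    obtain x where x: "x \<in> hom S c d" "x \<cdot> (k \<cdot> h) = w"
      and xu: "\<And>x'. x' \<in> hom S c d \<Longrightarrow> x' \<cdot> (k \<cdot> h) = w \<Longrightarrow> x' = x"
      using u[OF w] by blast
    show ?thesis
    proof (rule ex1I[of _ "x \<cdot> k"])
      show "x \<cdot> k \<in> hom S ?b d \<and> (x \<cdot> k) \<cdot> h = w"
        using comp_hom[OF k x(1)] comp_assoc[OF assms(2) k x(1)] x(2) by simp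
    next
      \<comment> \<open>For uniqueness, \<open>v \<cdot> s\<close> is another factorization of
        \<open>w\<close> through \<open>k \<cdot> h\<close>, since \<open>s \<cdot> k\<close> is the
        identity; so it equals \<open>x\<close>, and composing with \<open>k\<close> recovers
        \<open>v\<close>.\<close>
      fix v assume v: "v \<in> hom S ?b d \<and> v \<cdot> h = w"
      then have vh: "v \<in> hom S ?b d" by simp
      have 1: "(v \<cdot> s) \<cdot> k = v"
        using comp_assoc[OF k s(1) vh] sk comp_ide[OF vh] by simp
      then have "(v \<cdot> s) \<cdot> (k \<cdot> h) = w"
        using comp_assoc[OF assms(2) k comp_hom[OF s(1) vh]] v by simp
      from xu[OF comp_hom[OF s(1) vh] this] 1 show "v = x \<cdot> k" by simp
    qed
  qed
  have "is_coequalizer S f g h"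
    using f eq ex assms(2) tf homD[OF assms(2)] homD[OF f(1)]
    by (auto simp: is_coequalizer_def)
  then show ?thesis by (auto simp: regular_epi_def)
qed

lemma is_pullbackD:
  assumes "is_pullback S f g p q" "f \<in> hom S a c" "g \<in> hom S b c"
  shows "p \<in> hom S (src S p) a" "q \<in> hom S (src S p) b" "f \<cdot> p = g \<cdot> q"
    and "h \<in> hom S t a \<Longrightarrow> k \<in> hom S t b \<Longrightarrow> f \<cdot> h = g \<cdot> k
           \<Longrightarrow> \<exists>!u. u \<in> hom S t (src S p) \<and> p \<cdot> u = h \<and> q \<cdot> u = k"
  using assms(1) homD[OF assms(2)] homD[OF assms(3)] unfolding is_pullback_def by auto

end

section \<open>Inverse images, direct images and finite meets in a regular category\<close>

context regular_category
begin

lemma pullback_exists: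
  assumes "f \<in> hom S a c" "g \<in> hom S b c"
  obtains p q where "is_pullback S f g p q"
  using has_pullbacks[of f g] homD[OF assms(1)] homD[OF assms(2)] by metis

text \<open>Arrows into the pullback that agree under \<open>p\<close> also agree under
  \<open>q\<close>, as \<open>n\<close> is mono; so the uniqueness part of the universal property
  makes \<open>p\<close> mono. The existence part is the membership criterion.\<close>

lemma pullback_Sub:
  assumes "f \<in> hom S a b" "n \<in> Sub S b" "is_pullback S f n p q"
  shows "p \<in> Sub S a" "y \<in> hom S t a \<Longrightarrow> sub_le S y p \<longleftrightarrow> sub_le S (f \<cdot> y) n"
proof -
  note n = Sub_hom[OF assms(2)]
  note pb = is_pullbackD[OF assms(3,1) n]
  show p: "p \<in> Sub S a"
  proof (rule Sub_intro[OF pb(1)])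
    fix s u v assume u: "u \<in> hom S s (src S p)" and v: "v \<in> hom S s (src S p)" and e: "p \<cdot> u = p \<cdot> v"
    have nq: "n \<cdot> (q \<cdot> u) = f \<cdot> (p \<cdot> u)" "n \<cdot> (q \<cdot> v) = f \<cdot> (p \<cdot> v)"
      using comp_assoc[OF u pb(2) n] comp_assoc[OF v pb(2) n] pb(3)
        comp_assoc[OF u pb(1) assms(1)] comp_assoc[OF v pb(1) assms(1)] by auto
    with e have "q \<cdot> u = q \<cdot> v"
      using Sub_cancel[OF assms(2) comp_hom[OF u pb(2)] comp_hom[OF v pb(2)]] by simp
    with pb(4)[OF comp_hom[OF u pb(1)] comp_hom[OF u pb(2)] nq(1)[symmetric]] show "u = v"
      using u v e by auto
  qed
  assume y: "y \<in> hom S t a"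
  show "sub_le S y p \<longleftrightarrow> sub_le S (f \<cdot> y) n"
  proof
    assume "sub_le S y p"
    then obtain h where h: "h \<in> hom S t (src S p)" "p \<cdot> h = y" using sub_leE[OF _ y] by metis
    have "n \<cdot> (q \<cdot> h) = f \<cdot> y"
      using comp_assoc[OF h(1) pb(2) n] pb(3) comp_assoc[OF h(1) pb(1) assms(1)] h(2) by simp
    then show "sub_le S (f \<cdot> y) n"
      using sub_leI[OF comp_hom[OF y assms(1)] comp_hom[OF h(1) pb(2)]] by simp
  next
    assume "sub_le S (f \<cdot> y) n"
    then obtain k where k: "k \<in> hom S t (src S n)" "n \<cdot> k = f \<cdot> y"
      using sub_leE[OF _ comp_hom[OF y assms(1)]] by metis
    then obtain u where "u \<in> hom S t (src S p)" "p \<cdot> u = y"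
      using pb(4)[OF y k(1)] by metis
    then show "sub_le S y p" using sub_leI[OF y] by metis
  qed
qed

text \<open>\<open>inverse_image\<close> picks an arbitrary pullback. As \<open>pullback_Sub\<close>
  holds for every pullback, the choice does not matter.\<close>

lemma inverse_image:
  assumes "f \<in> hom S a b" "n \<in> Sub S b"
  shows inverse_image_Sub: "inverse_image S f n \<in> Sub S a"
    and sub_le_inverse_image:
      "y \<in> hom S t a \<Longrightarrow> sub_le S y (inverse_image S f n) \<longleftrightarrow> sub_le S (f \<cdot> y) n"
proof -
  have "\<exists>p q. is_pullback S f n p q"
    using pullback_exists[OF assms(1) Sub_hom[OF assms(2)]] by metis
  then have "\<exists>q. is_pullback S f n (inverse_image S f n) q"
    unfolding inverse_image_def by (rule someI_ex)
  then obtain q where q: "is_pullback S f n (inverse_image S f n) q" ..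
  show "inverse_image S f n \<in> Sub S a"
    "y \<in> hom S t a \<Longrightarrow> sub_le S y (inverse_image S f n) \<longleftrightarrow> sub_le S (f \<cdot> y) n"
    using pullback_Sub[OF assms q] by auto
qed

text \<open>Pulling \<open>e\<close> back along \<open>k\<close> yields both arrows at once: the
  projection to \<open>t\<close> is a cover by stability, and the other projection is the lift. In
  this sense a regular epimorphism is surjective on generalized elements, up to a cover.\<close>

lemma cover_lift:
  assumes "e \<in> hom S b c" "regular_epi S e" "k \<in> hom S t c"
  obtains s u x where "u \<in> hom S s t" "regular_epi S u" "x \<in> hom S s b" "e \<cdot> x = k \<cdot> u"
proof -
  obtain p q where pq: "is_pullback S k e p q" using pullback_exists[OF assms(3,1)] by metis
  note pb = is_pullbackD[OF pq assms(3,1)]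
  show thesis using that[OF pb(1) regular_epi_stable[OF pq assms(2)] pb(2)] pb(3) by simp
qed

text \<open>Here \<open>e\<close> is the coequalizer of the kernel pair of \<open>f\<close>, and
  \<open>n\<close> is the induced arrow. To see that \<open>n\<close> is mono, two elements that it
  identifies are lifted along \<open>e\<close> after passing to covers. The lifts agree under
  \<open>f\<close>, so they form an element of the kernel pair and are identified by
  \<open>e\<close>; the covers are then cancelled.\<close>

lemma image_factorization:
  assumes f: "f \<in> hom S a b"
  obtains n e where "n \<in> Sub S b" "e \<in> hom S a (src S n)" "regular_epi S e" "n \<cdot> e = f"
proof -
  obtain p q where pq: "is_pullback S f f p q" using pullback_exists[OF f f] by metis
  note pb = is_pullbackD[OF pq f f]
  obtain e where co: "is_coequalizer S p q e" using kernel_pair_coequalizer[OF pq] by metis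
  then have re: "regular_epi S e" by (auto simp: regular_epi_def)
  let ?c = "tgt S e"
  have tp: "tgt S p = a" using homD[OF pb(1)] by simp
  have e: "e \<in> hom S a ?c" "e \<cdot> p = e \<cdot> q"
    using co tp by (auto simp: is_coequalizer_def)
  obtain n where n: "n \<in> hom S ?c b" "n \<cdot> e = f"
  proof -
    have "\<exists>!n. n \<in> hom S ?c b \<and> n \<cdot> e = f"
      using co f pb(3) tp by (auto simp: is_coequalizer_def)
    then show thesis using that by blast
  qed
  have "n \<in> Sub S b"
  proof (rule Sub_intro[OF n(1)])
    fix t g h assume g: "g \<in> hom S t ?c" and h: "h \<in> hom S t ?c" and gh: "n \<cdot> g = n \<cdot> h"
    obtain s u x where u: "u \<in> hom S s t" "regular_epi S u" and x: "x \<in> hom S s a" "e \<cdot> x = g \<cdot> u"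
      using cover_lift[OF e(1) re g] by metis
    \<comment> \<open>The two lifts need a common domain, so \<open>h\<close> is lifted only after
      composition with the first cover \<open>u\<close>.\<close>
    obtain r v y where v: "v \<in> hom S r s" "regular_epi S v"
      and y: "y \<in> hom S r a" "e \<cdot> y = (h \<cdot> u) \<cdot> v"
      using cover_lift[OF e(1) re comp_hom[OF u(1) h]] by metis
    note gu = comp_hom[OF u(1) g] and hu = comp_hom[OF u(1) h] and xv = comp_hom[OF v(1) x(1)]
    have ngu: "n \<cdot> (g \<cdot> u) = n \<cdot> (h \<cdot> u)"
      using comp_assoc[OF u(1) g n(1)] comp_assoc[OF u(1) h n(1)] gh by simp
    have exv: "e \<cdot> (x \<cdot> v) = (g \<cdot> u) \<cdot> v"
      using comp_cong_left[OF x(2,1) e(1) v(1)] .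
    have "f \<cdot> (x \<cdot> v) = n \<cdot> ((g \<cdot> u) \<cdot> v)"
      using comp_assoc[OF xv e(1) n(1)] n(2) exv by simp
    also have "\<dots> = n \<cdot> ((h \<cdot> u) \<cdot> v)"
      using comp_assoc[OF v(1) gu n(1)] comp_assoc[OF v(1) hu n(1)] ngu by simp
    also have "\<dots> = f \<cdot> y"
      using comp_assoc[OF y(1) e(1) n(1)] n(2) y(2) by simp
    finally obtain w where w: "w \<in> hom S r (src S p)" "p \<cdot> w = x \<cdot> v" "q \<cdot> w = y"
      using pb(4)[OF xv y(1)] by metis
    have "e \<cdot> (x \<cdot> v) = e \<cdot> y"
      using comp_assoc[OF w(1) pb(1) e(1)] comp_assoc[OF w(1) pb(2) e(1)] w e(2) by simp
    then have "(g \<cdot> u) \<cdot> v = (h \<cdot> u) \<cdot> v" using exv y(2) by simp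
    then have "g \<cdot> u = h \<cdot> u" by (rule regular_epi_cancel[OF v(2,1) gu hu])
    then show "g = h" by (rule regular_epi_cancel[OF u(2,1) g h])
  qed
  then show thesis using that[of n e] e(1) re n(2) homD[OF n(1)] by simp
qed

lemma direct_image_factorization:
  assumes "f \<in> hom S a b" "m \<in> Sub S a"
  shows direct_image_Sub: "direct_image S f m \<in> Sub S b"
    and "\<exists>e \<in> hom S (src S m) (src S (direct_image S f m)).
           regular_epi S e \<and> direct_image S f m \<cdot> e = f \<cdot> m"
proof -
  obtain n e where "n \<in> Sub S b" "e \<in> hom S (src S m) (src S n)" "regular_epi S e" "n \<cdot> e = f \<cdot> m"
    using image_factorization[OF comp_hom[OF Sub_hom[OF assms(2)] assms(1)]] by metis
  then have "\<exists>n. n \<in> Sub S (tgt S f) \<and>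
      (\<exists>e \<in> hom S (src S m) (src S n). regular_epi S e \<and> n \<cdot> e = f \<cdot> m)"
    using homD[OF assms(1)] by auto
  from someI_ex[OF this, folded direct_image_def]
  show "direct_image S f m \<in> Sub S b"
    "\<exists>e \<in> hom S (src S m) (src S (direct_image S f m)).
       regular_epi S e \<and> direct_image S f m \<cdot> e = f \<cdot> m"
    using homD[OF assms(1)] by auto
qed

text \<open>The factor of \<open>y\<close> through the image is lifted along the regular epimorphism
  onto the image; the cover \<open>u\<close> comes from \<open>cover_lift\<close>.\<close>

lemma sub_le_direct_imageE:
  assumes f: "f \<in> hom S a b" and m: "m \<in> Sub S a" and y: "y \<in> hom S t b"
    and "sub_le S y (direct_image S f m)"
  obtains s u x where "u \<in> hom S s t" "regular_epi S u" "x \<in> hom S s a" "sub_le S x m" "f \<cdot> x = y \<cdot> u"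
proof -
  let ?n = "direct_image S f m"
  note n = Sub_hom[OF direct_image_Sub[OF f m]]
  obtain e where e: "e \<in> hom S (src S m) (src S ?n)" "regular_epi S e" "?n \<cdot> e = f \<cdot> m"
    using direct_image_factorization(2)[OF f m] by metis
  obtain k where k: "k \<in> hom S t (src S ?n)" "?n \<cdot> k = y"
    using sub_leE[OF assms(4) y] by metis
  obtain s u x where u: "u \<in> hom S s t" "regular_epi S u" and x: "x \<in> hom S s (src S m)" "e \<cdot> x = k \<cdot> u"
    using cover_lift[OF e(1,2) k(1)] by metis
  note mx = comp_hom[OF x(1) Sub_hom[OF m]]
  have "f \<cdot> (m \<cdot> x) = ?n \<cdot> (e \<cdot> x)"
    using comp_assoc[OF x(1) Sub_hom[OF m] f] comp_assoc[OF x(1) e(1) n] e(3) by simp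
  also have "\<dots> = y \<cdot> u"
    using x(2) comp_assoc[OF u(1) k(1) n] k(2) by simp
  finally show thesis
    using that[OF u mx] sub_leI[OF mx x(1)] by simp
qed

text \<open>A factor of \<open>x\<close> through \<open>m\<close>, followed by the arrow onto the
  image, puts \<open>y \<cdot> u\<close> in the image, and \<open>sub_le_cover\<close> removes
  \<open>u\<close>.\<close>

lemma sub_le_direct_imageI:
  assumes f: "f \<in> hom S a b" and m: "m \<in> Sub S a" and y: "y \<in> hom S t b"
    and u: "u \<in> hom S s t" "regular_epi S u" and x: "x \<in> hom S s a" "sub_le S x m"
    and eq: "f \<cdot> x = y \<cdot> u"
  shows "sub_le S y (direct_image S f m)"
proof (rule sub_le_cover[OF direct_image_Sub[OF f m] y u(2,1)])
  let ?n = "direct_image S f m"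
  note n = Sub_hom[OF direct_image_Sub[OF f m]]
  obtain e where e: "e \<in> hom S (src S m) (src S ?n)" "?n \<cdot> e = f \<cdot> m"
    using direct_image_factorization(2)[OF f m] by metis
  obtain k where k: "k \<in> hom S s (src S m)" "m \<cdot> k = x"
    using sub_leE[OF x(2,1)] by metis
  have "?n \<cdot> (e \<cdot> k) = f \<cdot> x"
    using comp_assoc[OF k(1) e(1) n] comp_assoc[OF k(1) Sub_hom[OF m] f] e(2) k(2) by simp
  then show "sub_le S (y \<cdot> u) ?n"
    using sub_leI[OF comp_hom[OF u(1) y] comp_hom[OF k(1) e(1)]] eq by simp
qed

text \<open>Finite meets are built by induction on \<open>P\<close>, starting from the identity: the
  meet of \<open>n\<close> and \<open>m\<close> is \<open>n\<close> composed with the inverse image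
  of \<open>m\<close> along \<open>n\<close>.\<close>

lemma meet:
  assumes "c \<in> Obj S" "finite P" "P \<subseteq> Sub S c"
  shows meet_Sub: "meet S c P \<in> Sub S c"
    and sub_le_meet: "y \<in> hom S t c \<Longrightarrow> sub_le S y (meet S c P) \<longleftrightarrow> (\<forall>n \<in> P. sub_le S y n)"
proof -
  have "\<exists>m \<in> Sub S c. \<forall>t. \<forall>y \<in> hom S t c. sub_le S y m \<longleftrightarrow> (\<forall>n \<in> P. sub_le S y n)"
    using assms(2,3)
  proof (induction P rule: finite_induct)
    case empty
    show ?case using ide_Sub[OF assms(1)] sub_le_ide by auto
  next
    case (insert n P)
    then obtain m where m: "m \<in> Sub S c"
      "\<forall>t. \<forall>y \<in> hom S t c. sub_le S y m \<longleftrightarrow> (\<forall>n \<in> P. sub_le S y n)" by auto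
    have n: "n \<in> Sub S c" using insert.prems by simp
    let ?p = "inverse_image S n m"
    note p = inverse_image[OF Sub_hom[OF n] m(1)]
    let ?m = "n \<cdot> ?p"
    have hm: "?m \<in> hom S (src S ?p) c" using comp_hom[OF Sub_hom[OF p(1)] Sub_hom[OF n]] .
    have sm: "?m \<in> Sub S c"
    proof (rule Sub_intro[OF hm])
      fix a f g assume f: "f \<in> hom S a (src S ?p)" and g: "g \<in> hom S a (src S ?p)"
        and eq: "?m \<cdot> f = ?m \<cdot> g"
      have "n \<cdot> (?p \<cdot> f) = n \<cdot> (?p \<cdot> g)"
        using eq comp_assoc[OF f Sub_hom[OF p(1)] Sub_hom[OF n]]
          comp_assoc[OF g Sub_hom[OF p(1)] Sub_hom[OF n]] by simp
      then have "?p \<cdot> f = ?p \<cdot> g"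
        using Sub_cancel[OF n comp_hom[OF f Sub_hom[OF p(1)]] comp_hom[OF g Sub_hom[OF p(1)]]] by simp
      then show "f = g" using Sub_cancel[OF p(1) f g] by simp
    qed
    have "sub_le S y ?m \<longleftrightarrow> sub_le S y n \<and> sub_le S y m" if y: "y \<in> hom S t c" for t y
    proof
      assume "sub_le S y ?m"
      then obtain h where h: "h \<in> hom S t (src S ?p)" "?m \<cdot> h = y"
        using sub_leE[OF _ y] homD[OF hm] by metis
      have ph: "?p \<cdot> h \<in> hom S t (src S n)" using comp_hom[OF h(1) Sub_hom[OF p(1)]] .
      have eq: "n \<cdot> (?p \<cdot> h) = y"
        using comp_assoc[OF h(1) Sub_hom[OF p(1)] Sub_hom[OF n]] h(2) by simp
      have "sub_le S (?p \<cdot> h) ?p" using sub_leI[OF ph h(1)] by simp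
      then have "sub_le S y m" using p(2)[OF ph] eq by simp
      then show "sub_le S y n \<and> sub_le S y m" using sub_leI[OF y ph eq] by simp
    next
      assume *: "sub_le S y n \<and> sub_le S y m"
      then obtain k where k: "k \<in> hom S t (src S n)" "n \<cdot> k = y" using sub_leE[OF _ y] by metis
      then have "sub_le S k ?p" using p(2)[OF k(1)] * by simp
      then obtain h where h: "h \<in> hom S t (src S ?p)" "?p \<cdot> h = k" using sub_leE[OF _ k(1)] by metis
      have "?m \<cdot> h = y"
        using comp_assoc[OF h(1) Sub_hom[OF p(1)] Sub_hom[OF n]] h(2) k(2) by simp
      then show "sub_le S y ?m" using sub_leI[OF y] h(1) homD[OF hm] by metis
    qed
    then show ?case using sm m(2) by (auto intro!: bexI[of _ ?m])
  qed
  then obtain m where m: "m \<in> Sub S c"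
    "\<And>t y. y \<in> hom S t c \<Longrightarrow> sub_le S y m \<longleftrightarrow> (\<forall>n \<in> P. sub_le S y n)" by metis
  have "is_meet S c P m"
    using m(1) m(2)[OF Sub_hom] sub_le_refl by (auto simp: is_meet_def)
  then have meet: "is_meet S c P (meet S c P)"
    unfolding meet_def by (rule someI)
  then show s: "meet S c P \<in> Sub S c" by (simp add: is_meet_def)
  \<comment> \<open>\<open>is_meet\<close> compares subobjects only, whereas the claim concerns
    arbitrary arrows \<open>y\<close>. The membership rule passes from the constructed
    \<open>m\<close> to the chosen meet through this inequality.\<close>
  have 1: "sub_le S m (meet S c P)" using meet m(1) m(2)[OF Sub_hom[OF m(1)]] sub_le_refl[OF m(1)]
    by (auto simp: is_meet_def)
  assume y: "y \<in> hom S t c"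
  show "sub_le S y (meet S c P) \<longleftrightarrow> (\<forall>n \<in> P. sub_le S y n)"
  proof
    assume *: "sub_le S y (meet S c P)"
    show "\<forall>n \<in> P. sub_le S y n"
      using sub_le_trans[OF s _ y *] meet assms(3) by (auto simp: is_meet_def)
  next
    assume "\<forall>n \<in> P. sub_le S y n"
    then show "sub_le S y (meet S c P)"
      using sub_le_trans[OF m(1) s y _ 1] m(2)[OF y] by simp
  qed
qed

end


section \<open>Semantic weakening\<close>

lemma has_sort_mono: "has_sort L U t s \<Longrightarrow> U \<subseteq> V \<Longrightarrow> has_sort L V t s"
  by (induction rule: has_sort.induct)
    (auto intro: has_sort.intros elim!: list_all2_mono)

lemma has_sort_Int: "has_sort L U t s \<Longrightarrow> has_sort L V t s' \<Longrightarrow> has_sort L (U \<inter> V) t s"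
proof (induction arbitrary: s' rule: has_sort.induct)
  case (Var x)
  then show ?case by (auto elim: has_sort.cases intro: has_sort.intros)
next
  case (Fn f ts)
  then have "list_all2 (has_sort L V) ts (fun_args L f)"
    by (auto elim: has_sort.cases)
  with Fn.IH have "list_all2 (has_sort L (U \<inter> V)) ts (fun_args L f)"
    by (fastforce simp: list_all2_conv_all_nth)
  with Fn.hyps show ?case by (auto intro: has_sort.intros)
qed

lemma in_context_mono: "in_context L U \<phi> \<Longrightarrow> U \<subseteq> V \<Longrightarrow> in_context L V \<phi>"
proof (induction \<phi> arbitrary: U V)
  case (Rel r ts)
  then show ?case by (auto elim!: list_all2_mono intro: has_sort_mono)
next
  case (Ex x \<phi>)
  then show ?case using insert_mono[OF Ex.prems(2)] by (metis in_context.simps(4))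
qed auto

text \<open>This lets a formula move between two simplices that are not nested, by way of their
  common face. Under a quantifier it relies on \<open>insert x\<close> distributing over
  intersections.\<close>

lemma in_context_Int: "in_context L U \<phi> \<Longrightarrow> in_context L V \<phi> \<Longrightarrow> in_context L (U \<inter> V) \<phi>"
proof (induction \<phi> arbitrary: U V)
  case (Rel r ts)
  then show ?case by (auto simp: list_all2_conv_all_nth intro: has_sort_Int)
next
  case (Ex x \<phi>)
  then show ?case using Ex.IH[of "insert x U" "insert x V"] by simp
qed auto

section \<open>Context products, projections and the interpretation of terms\<close>

locale interpreted_category = regular_category S + regular_interpretation S L I
  for S :: "('o, 'a, 'm) category_scheme" (structure)
    and L :: "('s, 'f, 'r, 'v, 'n) language_scheme"
    and I :: "('s, 'f, 'r, 'v, 'o, 'a, 'p) interp_scheme"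
begin

lemma is_productD:
  assumes "is_product S J D P p"
  shows "P \<in> Obj S" "i \<in> J \<Longrightarrow> p i \<in> hom S P (D i)"
    and "t \<in> Obj S \<Longrightarrow> (\<And>i. i \<in> J \<Longrightarrow> q i \<in> hom S t (D i))
           \<Longrightarrow> \<exists>!u. u \<in> hom S t P \<and> (\<forall>i \<in> J. p i \<cdot> u = q i)"
  using assms by (auto simp: is_product_def)

lemma is_product_eqI:
  assumes "is_product S J D P p" "y \<in> hom S t P" "z \<in> hom S t P"
    and "\<And>i. i \<in> J \<Longrightarrow> p i \<cdot> y = p i \<cdot> z"
  shows "y = z"
proof -
  have "\<exists>!u. u \<in> hom S t P \<and> (\<forall>i \<in> J. p i \<cdot> u = p i \<cdot> z)"
    using is_productD(3)[OF assms(1), of t "\<lambda>i. p i \<cdot> z"] hom_Obj[OF assms(2)]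
      comp_hom[OF assms(3) is_productD(2)[OF assms(1)]] by auto
  then show ?thesis using assms(2,3,4) by blast
qed

context
  fixes U :: "'v set"
  assumes U: "finite U" "U \<subseteq> Vars L"
begin

lemma ctx_Obj: "ctx I U \<in> Obj S"
  using is_productD(1)[OF ctx_product[OF U]] .

lemma ctx_pr: "x \<in> U \<Longrightarrow> ctx_pr I U x \<in> hom S (ctx I U) (sort_obj I (var_sort L x))"
  using is_productD(2)[OF ctx_product[OF U]] .

lemmas ctx_eqI = is_product_eqI[OF ctx_product[OF U]]

lemma ctx_tuple:
  assumes "t \<in> Obj S" "\<And>x. x \<in> U \<Longrightarrow> q x \<in> hom S t (sort_obj I (var_sort L x))"
  obtains u where "u \<in> hom S t (ctx I U)" "\<And>x. x \<in> U \<Longrightarrow> ctx_pr I U x \<cdot> u = q x"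
  using is_productD(3)[OF ctx_product[OF U] assms] by blast

lemma tuple:
  assumes "length hs = length ss"
    and "\<And>i. i < length ss \<Longrightarrow> hs ! i \<in> hom S (ctx I U) (sort_obj I (ss ! i))"
  shows tuple_hom: "tuple S I U ss hs \<in> hom S (ctx I U) (args I ss)"
    and args_pr_tuple: "i < length ss \<Longrightarrow> args_pr I ss i \<cdot> tuple S I U ss hs = hs ! i"
proof -
  have "\<exists>!u. u \<in> hom S (ctx I U) (args I ss) \<and> (\<forall>i \<in> {..<length ss}. args_pr I ss i \<cdot> u = hs ! i)"
    using is_productD(3)[OF args_product ctx_Obj, of ss "\<lambda>i. hs ! i"] assms(2) by auto
  then have "\<exists>!u. u \<in> hom S (ctx I U) (args I ss) \<and> (\<forall>i < length ss. args_pr I ss i \<cdot> u = hs ! i)"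
    by (simp add: Ball_def)
  from theI'[OF this, folded tuple_def]
  show "tuple S I U ss hs \<in> hom S (ctx I U) (args I ss)"
    "i < length ss \<Longrightarrow> args_pr I ss i \<cdot> tuple S I U ss hs = hs ! i"
    by auto
qed

lemma tm_arr_hom: "has_sort L U t s \<Longrightarrow> tm_arr S L I U t \<in> hom S (ctx I U) (sort_obj I s)"
proof (induction rule: has_sort.induct)
  case (Var x)
  then show ?case by (simp add: ctx_pr)
next
  case (Fn f ts)
  then have "tuple S I U (fun_args L f) (map (tm_arr S L I U) ts) \<in> hom S (ctx I U) (args I (fun_args L f))"
    by (intro tuple_hom) (auto simp: list_all2_conv_all_nth)
  then show ?case using comp_hom fun_arr[OF Fn.hyps(1)] by simp
qed

lemma tuple_tm_arr_hom:
  assumes "list_all2 (has_sort L U) ts ss"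
  shows "tuple S I U ss (map (tm_arr S L I U) ts) \<in> hom S (ctx I U) (args I ss)"
  using assms by (intro tuple_hom) (auto simp: list_all2_conv_all_nth tm_arr_hom)

end

lemma proj:
  assumes "finite V" "V \<subseteq> Vars L" "U \<subseteq> V"
  shows proj_hom: "proj S I U V \<in> hom S (ctx I V) (ctx I U)"
    and ctx_pr_proj: "x \<in> U \<Longrightarrow> ctx_pr I U x \<cdot> proj S I U V = ctx_pr I V x"
proof -
  have U: "finite U" "U \<subseteq> Vars L" using assms finite_subset by auto
  have "\<exists>!u. u \<in> hom S (ctx I V) (ctx I U) \<and> (\<forall>x \<in> U. ctx_pr I U x \<cdot> u = ctx_pr I V x)"
    using is_productD(3)[OF ctx_product[OF U] ctx_Obj[OF assms(1,2)], of "ctx_pr I V"]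
      ctx_pr[OF assms(1,2)] assms(3) by auto
  from theI'[OF this, folded proj_def]
  show "proj S I U V \<in> hom S (ctx I V) (ctx I U)"
    "x \<in> U \<Longrightarrow> ctx_pr I U x \<cdot> proj S I U V = ctx_pr I V x" by auto
qed

lemma ctx_pr_proj_comp:
  assumes "finite V" "V \<subseteq> Vars L" "U \<subseteq> V" "y \<in> hom S t (ctx I V)" "x \<in> U"
  shows "ctx_pr I U x \<cdot> (proj S I U V \<cdot> y) = ctx_pr I V x \<cdot> y"
proof -
  have U: "finite U" "U \<subseteq> Vars L" using assms finite_subset by auto
  show ?thesis
    using comp_cong_left[OF ctx_pr_proj[OF assms(1-3,5)] proj_hom[OF assms(1-3)] ctx_pr[OF U assms(5)] assms(4)] .
qed

text \<open>Functoriality of the projections, composed with \<open>y\<close> so that it rewrites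
  generalized elements directly. Both sides have the same components.\<close>

lemma proj_proj:
  assumes "finite W" "W \<subseteq> Vars L" "V \<subseteq> W" "U \<subseteq> V" "y \<in> hom S t (ctx I W)"
  shows "proj S I U V \<cdot> (proj S I V W \<cdot> y) = proj S I U W \<cdot> y"
proof -
  have V: "finite V" "V \<subseteq> Vars L" and UW: "U \<subseteq> W"
    using assms finite_subset by auto
  then have U: "finite U" "U \<subseteq> Vars L" using assms(4) finite_subset by auto
  note yV = comp_hom[OF assms(5) proj_hom[OF assms(1-3)]]
  show ?thesis
  proof (rule ctx_eqI[OF U comp_hom[OF yV proj_hom[OF V assms(4)]] comp_hom[OF assms(5) proj_hom[OF assms(1,2) UW]]])
    fix x assume x: "x \<in> U"
    then have xV: "x \<in> V" using assms(4) by auto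
    show "ctx_pr I U x \<cdot> (proj S I U V \<cdot> (proj S I V W \<cdot> y)) = ctx_pr I U x \<cdot> (proj S I U W \<cdot> y)"
      by (simp add: ctx_pr_proj_comp[OF V assms(4) yV x] ctx_pr_proj_comp[OF assms(1-3,5) xV]
          ctx_pr_proj_comp[OF assms(1,2) UW assms(5) x])
  qed
qed

lemma proj_self:
  assumes "finite U" "U \<subseteq> Vars L" "y \<in> hom S t (ctx I U)"
  shows "proj S I U U \<cdot> y = y"
proof (rule ctx_eqI[OF assms(1,2) comp_hom[OF assms(3) proj_hom[OF assms(1,2) subset_refl]] assms(3)])
  fix x assume "x \<in> U"
  then show "ctx_pr I U x \<cdot> (proj S I U U \<cdot> y) = ctx_pr I U x \<cdot> y"
    using ctx_pr_proj_comp[OF assms(1,2) subset_refl assms(3)] by simp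
qed

lemma tuple_proj:
  assumes "finite V" "V \<subseteq> Vars L" "U \<subseteq> V" "length hs = length ss" "length ks = length ss"
    and "\<And>i. i < length ss \<Longrightarrow> hs ! i \<in> hom S (ctx I U) (sort_obj I (ss ! i))"
    and "\<And>i. i < length ss \<Longrightarrow> ks ! i = hs ! i \<cdot> proj S I U V"
  shows "tuple S I V ss ks = tuple S I U ss hs \<cdot> proj S I U V"
proof -
  have U: "finite U" "U \<subseteq> Vars L" using assms finite_subset by auto
  note p = proj_hom[OF assms(1-3)]
  have ks: "ks ! i \<in> hom S (ctx I V) (sort_obj I (ss ! i))" if "i < length ss" for i
    using comp_hom[OF p assms(6)[OF that]] assms(7)[OF that] by simp
  note tU = tuple[OF U assms(4,6)] and tV = tuple[OF assms(1,2,5) ks]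
  show ?thesis
  proof (rule is_product_eqI[OF args_product tV(1) comp_hom[OF p tU(1)]])
    fix i assume i: "i \<in> {..<length ss}"
    then have i': "i < length ss" by simp
    show "args_pr I ss i \<cdot> tuple S I V ss ks = args_pr I ss i \<cdot> (tuple S I U ss hs \<cdot> proj S I U V)"
      using tV(2)[OF _ i'] comp_cong_left[OF tU(2)[OF _ i'] tU(1) is_productD(2)[OF args_product i] p]
        assms(7)[OF i'] by simp
  qed simp_all
qed

lemma tm_arr_proj:
  assumes V: "finite V" "V \<subseteq> Vars L" "U \<subseteq> V"
  shows "has_sort L U t s \<Longrightarrow> tm_arr S L I V t = tm_arr S L I U t \<cdot> proj S I U V"
proof (induction rule: has_sort.induct)
  case (Var x)
  then show ?case by (simp add: ctx_pr_proj[OF V])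
next
  case (Fn f ts)
  have U: "finite U" "U \<subseteq> Vars L" using V finite_subset by auto
  have ts: "list_all2 (has_sort L U) ts (fun_args L f)"
    using Fn.IH by (auto simp: list_all2_conv_all_nth)
  have "tuple S I V (fun_args L f) (map (tm_arr S L I V) ts)
      = tuple S I U (fun_args L f) (map (tm_arr S L I U) ts) \<cdot> proj S I U V"
    using Fn.IH by (intro tuple_proj[OF V]) (auto simp: list_all2_conv_all_nth tm_arr_hom[OF U])
  then show ?case
    using comp_assoc[OF proj_hom[OF V] tuple_tm_arr_hom[OF U ts] fun_arr[OF Fn.hyps(1)]] by simp
qed

section \<open>Interpretation of formulas as subobjects\<close>

lemma fm_sub_Sub:
  "finite U \<Longrightarrow> U \<subseteq> Vars L \<Longrightarrow> in_context L U \<phi> \<Longrightarrow> fm_sub S L I U \<phi> \<in> Sub S (ctx I U)"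
proof (induction \<phi> arbitrary: U)
  case (Rel r ts)
  then show ?case using inverse_image_Sub[OF tuple_tm_arr_hom rel_sub] by simp
next
  case Top
  then show ?case using ide_Sub ctx_Obj by simp
next
  case (And \<phi> \<psi>)
  then show ?case by (auto intro!: meet_Sub ctx_Obj)
next
  case (Ex x \<phi>)
  have 1: "finite (insert x U)" "insert x U \<subseteq> Vars L" "U - {x} \<subseteq> insert x U" using Ex.prems by auto
  have 2: "U - {x} \<subseteq> U" by auto
  show ?case
    using inverse_image_Sub[OF proj_hom[OF Ex.prems(1,2) 2]
        direct_image_Sub[OF proj_hom[OF 1] Ex.IH[OF 1(1,2)]]] Ex.prems(3) by simp
qed

lemma sub_le_fm_sub_And:
  assumes "finite U" "U \<subseteq> Vars L" "in_context L U (And \<phi> \<psi>)" "y \<in> hom S t (ctx I U)"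
  shows "sub_le S y (fm_sub S L I U (And \<phi> \<psi>))
    \<longleftrightarrow> sub_le S y (fm_sub S L I U \<phi>) \<and> sub_le S y (fm_sub S L I U \<psi>)"
  using assms fm_sub_Sub sub_le_meet[OF ctx_Obj, of U "{fm_sub S L I U \<phi>, fm_sub S L I U \<psi>}"] by simp

text \<open>The body of the quantifier lives over \<open>insert x U\<close> and its direct image
  over \<open>U - {x}\<close>; collecting the facts in this form avoids a case distinction on
  whether \<open>x\<close> is in \<open>U\<close>.\<close>

lemma Ex_context:
  assumes "finite U" "U \<subseteq> Vars L" "in_context L U (Ex x \<phi>)"
  shows "finite (insert x U)" "insert x U \<subseteq> Vars L" "finite (U - {x})" "U - {x} \<subseteq> Vars L"
    "U - {x} \<subseteq> insert x U" "U - {x} \<subseteq> U"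
    "fm_sub S L I (insert x U) \<phi> \<in> Sub S (ctx I (insert x U))"
  using assms fm_sub_Sub[of "insert x U" \<phi>] by auto

text \<open>This is the Kripke-Joyal clause for the quantifier. The witness \<open>z\<close> agrees
  with \<open>y\<close>, after the cover \<open>u\<close>, on \<open>U - {x}\<close> only; its
  component at \<open>x\<close> is free even when \<open>x\<close> is in \<open>U\<close>.\<close>

lemma sub_le_fm_sub_ExE:
  assumes "finite U" "U \<subseteq> Vars L" "in_context L U (Ex x \<phi>)" "y \<in> hom S t (ctx I U)"
    and "sub_le S y (fm_sub S L I U (Ex x \<phi>))"
  obtains s u z where "u \<in> hom S s t" "regular_epi S u" "z \<in> hom S s (ctx I (insert x U))"
    "sub_le S z (fm_sub S L I (insert x U) \<phi>)"
    "proj S I (U - {x}) (insert x U) \<cdot> z = (proj S I (U - {x}) U \<cdot> y) \<cdot> u"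
proof -
  note x = Ex_context[OF assms(1-3)]
  note p = proj_hom[OF x(1,2,5)] and q = proj_hom[OF assms(1,2) x(6)]
  have "sub_le S (proj S I (U - {x}) U \<cdot> y)
      (direct_image S (proj S I (U - {x}) (insert x U)) (fm_sub S L I (insert x U) \<phi>))"
    using assms(5) sub_le_inverse_image[OF q direct_image_Sub[OF p x(7)] assms(4)] by simp
  from sub_le_direct_imageE[OF p x(7) comp_hom[OF assms(4) q] this] show thesis
    using that by metis
qed

lemma sub_le_fm_sub_ExI:
  assumes "finite U" "U \<subseteq> Vars L" "in_context L U (Ex x \<phi>)" "y \<in> hom S t (ctx I U)"
    and "u \<in> hom S s t" "regular_epi S u" "z \<in> hom S s (ctx I (insert x U))"
    "sub_le S z (fm_sub S L I (insert x U) \<phi>)"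
    "proj S I (U - {x}) (insert x U) \<cdot> z = (proj S I (U - {x}) U \<cdot> y) \<cdot> u"
  shows "sub_le S y (fm_sub S L I U (Ex x \<phi>))"
proof -
  note x = Ex_context[OF assms(1-3)]
  note p = proj_hom[OF x(1,2,5)] and q = proj_hom[OF assms(1,2) x(6)]
  show ?thesis
    using sub_le_inverse_image[OF q direct_image_Sub[OF p x(7)] assms(4)]
      sub_le_direct_imageI[OF p x(7) comp_hom[OF assms(4) q] assms(5-9)] by simp
qed

text \<open>For \<open>Ex\<close> this is the Beck-Chevalley condition: a witness over the small context is
  glued with the components of \<open>y\<close> to a witness over the large one.\<close>

lemma fm_sub_proj:
  "finite V \<Longrightarrow> V \<subseteq> Vars L \<Longrightarrow> U \<subseteq> V \<Longrightarrow> in_context L U \<phi> \<Longrightarrow> y \<in> hom S t (ctx I V) \<Longrightarrow>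
     sub_le S y (fm_sub S L I V \<phi>) \<longleftrightarrow> sub_le S (proj S I U V \<cdot> y) (fm_sub S L I U \<phi>)"
proof (induction \<phi> arbitrary: U V y t)
  case (Rel r ts)
  note V = Rel.prems(1-3)
  have U: "finite U" "U \<subseteq> Vars L" using V finite_subset by auto
  have r: "r \<in> Rels L" and ts: "list_all2 (has_sort L U) ts (rel_args L r)" using Rel.prems(4) by auto
  have tsV: "list_all2 (has_sort L V) ts (rel_args L r)"
    using ts V(3) by (auto simp: list_all2_conv_all_nth intro: has_sort_mono)
  have eq: "tuple S I V (rel_args L r) (map (tm_arr S L I V) ts)
      = tuple S I U (rel_args L r) (map (tm_arr S L I U) ts) \<cdot> proj S I U V"
    using ts
    by (intro tuple_proj[OF V]) (auto simp: list_all2_conv_all_nth tm_arr_hom[OF U] tm_arr_proj[OF V])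
  note p = proj_hom[OF V]
  show ?case
    using sub_le_inverse_image[OF tuple_tm_arr_hom[OF V(1,2) tsV] rel_sub[OF r] Rel.prems(5)]
      sub_le_inverse_image[OF tuple_tm_arr_hom[OF U ts] rel_sub[OF r] comp_hom[OF Rel.prems(5) p]]
      comp_assoc[OF Rel.prems(5) p tuple_tm_arr_hom[OF U ts]] eq by simp
next
  case Top
  then show ?case using sub_le_ide[OF Top.prems(5)] sub_le_ide[OF comp_hom[OF Top.prems(5) proj_hom]] by simp
next
  case (And \<phi> \<psi>)
  note V = And.prems(1-3)
  have U: "finite U" "U \<subseteq> Vars L" using V finite_subset by auto
  show ?case
    using sub_le_fm_sub_And[OF V(1,2) in_context_mono[OF And.prems(4) V(3)] And.prems(5)]
      sub_le_fm_sub_And[OF U And.prems(4) comp_hom[OF And.prems(5) proj_hom[OF V]]]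
      And.IH[OF V _ And.prems(5)] And.prems(4) by simp
next
  case (Ex x \<phi>)
  note V = Ex.prems(1-3) and y = Ex.prems(5)
  have U: "finite U" "U \<subseteq> Vars L" using V finite_subset by auto
  have inV: "in_context L V (Ex x \<phi>)" using in_context_mono[OF Ex.prems(4) V(3)] .
  have in\<phi>: "in_context L (insert x U) \<phi>" using Ex.prems(4) by simp
  note xV = Ex_context[OF V(1,2) inV] and xU = Ex_context[OF U Ex.prems(4)]
  have sub: "insert x U \<subseteq> insert x V" "U - {x} \<subseteq> V - {x}" "U - {x} \<subseteq> insert x V" "U - {x} \<subseteq> V"
    using V(3) by auto
  note Uy = comp_hom[OF y proj_hom[OF V]]
  show ?case
  proof
    assume "sub_le S y (fm_sub S L I V (Ex x \<phi>))"
    then obtain s u z where u: "u \<in> hom S s t" "regular_epi S u"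
      and z: "z \<in> hom S s (ctx I (insert x V))" "sub_le S z (fm_sub S L I (insert x V) \<phi>)"
      and eq: "proj S I (V - {x}) (insert x V) \<cdot> z = (proj S I (V - {x}) V \<cdot> y) \<cdot> u"
      using sub_le_fm_sub_ExE[OF V(1,2) inV y] by metis
    let ?z = "proj S I (insert x U) (insert x V) \<cdot> z"
    have z': "?z \<in> hom S s (ctx I (insert x U))"
      using comp_hom[OF z(1) proj_hom[OF xV(1,2) sub(1)]] .
    have le: "sub_le S ?z (fm_sub S L I (insert x U) \<phi>)"
      using Ex.IH[OF xV(1,2) sub(1) in\<phi> z(1)] z(2) by simp
    \<comment> \<open>The restricted witness is compared with \<open>y\<close> over
      \<open>U - {x}\<close>, going through \<open>V - {x}\<close>, where \<open>eq\<close> is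
      available.\<close>
    have "proj S I (U - {x}) (insert x U) \<cdot> ?z
        = proj S I (U - {x}) (V - {x}) \<cdot> (proj S I (V - {x}) (insert x V) \<cdot> z)"
      using proj_proj[OF xV(1,2) sub(1) xU(5) z(1)] proj_proj[OF xV(1,2,5) sub(2) z(1)] by simp
    also have "\<dots> = (proj S I (U - {x}) (V - {x}) \<cdot> (proj S I (V - {x}) V \<cdot> y)) \<cdot> u"
      using eq comp_assoc[OF u(1) comp_hom[OF y proj_hom[OF V(1,2) xV(6)]] proj_hom[OF xV(3,4) sub(2)]]
      by simp
    also have "\<dots> = (proj S I (U - {x}) U \<cdot> (proj S I U V \<cdot> y)) \<cdot> u"
      using proj_proj[OF V(1,2) xV(6) sub(2) y] proj_proj[OF V xU(6) y] by simp
    finally show "sub_le S (proj S I U V \<cdot> y) (fm_sub S L I U (Ex x \<phi>))"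
      using sub_le_fm_sub_ExI[OF U Ex.prems(4) Uy u z' le] by simp
  next
    assume "sub_le S (proj S I U V \<cdot> y) (fm_sub S L I U (Ex x \<phi>))"
    then obtain s u z where u: "u \<in> hom S s t" "regular_epi S u"
      and z: "z \<in> hom S s (ctx I (insert x U))" "sub_le S z (fm_sub S L I (insert x U) \<phi>)"
      and eq: "proj S I (U - {x}) (insert x U) \<cdot> z = (proj S I (U - {x}) U \<cdot> (proj S I U V \<cdot> y)) \<cdot> u"
      using sub_le_fm_sub_ExE[OF U Ex.prems(4) Uy] by metis
    note yu = comp_hom[OF u(1) y]
    have eq': "proj S I (U - {x}) (insert x U) \<cdot> z = proj S I (U - {x}) V \<cdot> (y \<cdot> u)"
      using eq proj_proj[OF V xU(6) y] comp_assoc[OF u(1) y proj_hom[OF V(1,2) sub(4)]] by simp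
    \<comment> \<open>The components of the glued witness: the one at \<open>x\<close> comes from
      \<open>z\<close>, all others from \<open>y\<close>. If \<open>x\<close> is in
      \<open>V\<close>, the component of \<open>y\<close> at \<open>x\<close> is thereby
      overwritten.\<close>
    define q where "q v = (if v = x then ctx_pr I (insert x U) x \<cdot> z else ctx_pr I V v \<cdot> (y \<cdot> u))" for v
    have "q v \<in> hom S s (sort_obj I (var_sort L v))" if "v \<in> insert x V" for v
      using that comp_hom[OF z(1) ctx_pr[OF xU(1,2)]] comp_hom[OF yu ctx_pr[OF V(1,2)]]
      by (auto simp: q_def)
    then obtain w where w: "w \<in> hom S s (ctx I (insert x V))"
      "\<And>v. v \<in> insert x V \<Longrightarrow> ctx_pr I (insert x V) v \<cdot> w = q v"
      using ctx_tuple[OF xV(1,2), of s q] hom_Obj[OF u(1)] by auto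
    have wz: "proj S I (insert x U) (insert x V) \<cdot> w = z"
    proof (rule ctx_eqI[OF xU(1,2) comp_hom[OF w(1) proj_hom[OF xV(1,2) sub(1)]] z(1)])
      fix v assume v: "v \<in> insert x U"
      then have vV: "v \<in> insert x V" using V(3) by auto
      have "q v = ctx_pr I (insert x U) v \<cdot> z"
      proof (cases "v = x")
        case False
        then have vx: "v \<in> U - {x}" using v by simp
        have "ctx_pr I (U - {x}) v \<cdot> (proj S I (U - {x}) (insert x U) \<cdot> z)
            = ctx_pr I (U - {x}) v \<cdot> (proj S I (U - {x}) V \<cdot> (y \<cdot> u))"
          using eq' by simp
        then show ?thesis
          using False ctx_pr_proj_comp[OF xU(1,2,5) z(1) vx] ctx_pr_proj_comp[OF V(1,2) sub(4) yu vx]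
          by (simp add: q_def)
      qed (simp add: q_def)
      then show "ctx_pr I (insert x U) v \<cdot> (proj S I (insert x U) (insert x V) \<cdot> w)
          = ctx_pr I (insert x U) v \<cdot> z"
        using ctx_pr_proj_comp[OF xV(1,2) sub(1) w(1) v] w(2)[OF vV] by simp
    qed
    have le: "sub_le S w (fm_sub S L I (insert x V) \<phi>)"
      using Ex.IH[OF xV(1,2) sub(1) in\<phi> w(1)] wz z(2) by simp
    have "proj S I (V - {x}) (insert x V) \<cdot> w = proj S I (V - {x}) V \<cdot> (y \<cdot> u)"
    proof (rule ctx_eqI[OF xV(3,4) comp_hom[OF w(1) proj_hom[OF xV(1,2,5)]]
            comp_hom[OF yu proj_hom[OF V(1,2) xV(6)]]])
      fix v assume v: "v \<in> V - {x}"
      then show "ctx_pr I (V - {x}) v \<cdot> (proj S I (V - {x}) (insert x V) \<cdot> w)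
          = ctx_pr I (V - {x}) v \<cdot> (proj S I (V - {x}) V \<cdot> (y \<cdot> u))"
        using ctx_pr_proj_comp[OF xV(1,2,5) w(1) v] ctx_pr_proj_comp[OF V(1,2) xV(6) yu v] w(2)[of v]
        by (simp add: q_def)
    qed
    then show "sub_le S y (fm_sub S L I V (Ex x \<phi>))"
      using sub_le_fm_sub_ExI[OF V(1,2) inV y u w(1) le]
        comp_assoc[OF u(1) y proj_hom[OF V(1,2) xV(6)]] by simp
  qed
qed


section \<open>Soundness of the inchworm fragment\<close>

lemma sub_le_fm_sub_conj:
  assumes "finite U" "U \<subseteq> Vars L" "y \<in> hom S t (ctx I U)"
  shows "set \<phi>s \<subseteq> Fm L U \<Longrightarrow>
    sub_le S y (fm_sub S L I U (foldr And \<phi>s Top)) \<longleftrightarrow> (\<forall>\<phi> \<in> set \<phi>s. sub_le S y (fm_sub S L I U \<phi>))"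
proof (induction \<phi>s)
  case Nil
  then show ?case using sub_le_ide[OF assms(3)] by simp
next
  case (Cons \<phi> \<phi>s)
  have "in_context L U (foldr And \<phi>s Top)"
    using Cons.prems by (induction \<phi>s) (auto simp: Fm_def)
  then have "in_context L U (And \<phi> (foldr And \<phi>s Top))"
    using Cons.prems by (simp add: Fm_def)
  from sub_le_fm_sub_And[OF assms(1,2) this assms(3)] show ?case
    using Cons by simp
qed

lemma in_context_foldr_Ex:
  "set xs \<subseteq> Vars L \<Longrightarrow> in_context L (U \<union> set xs) \<phi> \<Longrightarrow> in_context L U (foldr Ex xs \<phi>)"
  by (induction xs arbitrary: U) auto

text \<open>Each quantifier introduces its own cover. Aiming at membership in an arbitrary subobject
  \<open>n\<close> lets each cover be dropped at once by \<open>sub_le_cover\<close>. The induction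
  step replaces \<open>n\<close> by its inverse image over the context with one more
  variable.\<close>

lemma sub_le_foldr_Ex:
  assumes "distinct xs" "set xs \<inter> U = {}" "finite U" "U \<union> set xs \<subseteq> Vars L"
    and "in_context L (U \<union> set xs) \<phi>" "y \<in> hom S t (ctx I U)" "n \<in> Sub S (ctx I U)"
    and "sub_le S y (fm_sub S L I U (foldr Ex xs \<phi>))"
    and "\<And>s w. w \<in> hom S s (ctx I (U \<union> set xs)) \<Longrightarrow> sub_le S w (fm_sub S L I (U \<union> set xs) \<phi>)
           \<Longrightarrow> sub_le S (proj S I U (U \<union> set xs) \<cdot> w) n"
  shows "sub_le S y n"
  using assms
proof (induction xs arbitrary: U y t n)
  case Nil
  then show ?case using proj_self[of U y t] Nil.prems(9)[of y t] by simp
next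
  case (Cons x xs)
  have U: "finite U" "U \<subseteq> Vars L" "U - {x} = U" using Cons.prems(2,3,4) by auto
  have V: "insert x U \<union> set xs = U \<union> set (x # xs)" by auto
  have fV: "finite (U \<union> set (x # xs))" "insert x U \<subseteq> U \<union> set (x # xs)" using U(1) by auto
  have "in_context L (insert x U) (foldr Ex xs \<phi>)"
    using Cons.prems(4,5) by (intro in_context_foldr_Ex) (auto simp: V)
  then have ic: "in_context L U (Ex x (foldr Ex xs \<phi>))" using Cons.prems(4) by simp
  note x = Ex_context[OF U(1,2) ic, unfolded U(3)]
  note y = Cons.prems(6) and n = Cons.prems(7)
  \<comment> \<open>Since \<open>x\<close> is not in \<open>U\<close>, the inverse image in the
    clause for \<open>Ex\<close> is taken along \<open>proj S I U U\<close>, which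
    \<open>proj_self\<close> removes.\<close>
  obtain s u z where u: "u \<in> hom S s t" "regular_epi S u"
    and z: "z \<in> hom S s (ctx I (insert x U))" "sub_le S z (fm_sub S L I (insert x U) (foldr Ex xs \<phi>))"
    and eq: "proj S I U (insert x U) \<cdot> z = y \<cdot> u"
  proof (rule sub_le_fm_sub_ExE[OF U(1,2) ic y])
    show "sub_le S y (fm_sub S L I U (Ex x (foldr Ex xs \<phi>)))" using Cons.prems(8) by simp
  qed (simp add: U(3) proj_self[OF U(1,2) y])
  note p = proj_hom[OF x(1,2,5)]
  let ?n = "inverse_image S (proj S I U (insert x U)) n"
  have "sub_le S z ?n"
  proof (rule Cons.IH[OF _ _ x(1) _ _ z(1) inverse_image_Sub[OF p n] z(2)])
    fix s w assume w: "w \<in> hom S s (ctx I (insert x U \<union> set xs))"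
      "sub_le S w (fm_sub S L I (insert x U \<union> set xs) \<phi>)"
    then have w': "w \<in> hom S s (ctx I (U \<union> set (x # xs)))" unfolding V by simp
    have "sub_le S (proj S I U (insert x U) \<cdot> (proj S I (insert x U) (U \<union> set (x # xs)) \<cdot> w)) n"
      using Cons.prems(9)[OF w'] w(2) proj_proj[OF fV(1) Cons.prems(4) fV(2) x(5) w']
      unfolding V by simp
    then show "sub_le S (proj S I (insert x U) (insert x U \<union> set xs) \<cdot> w) ?n"
      using sub_le_inverse_image[OF p n comp_hom[OF w' proj_hom[OF fV(1) Cons.prems(4) fV(2)]]]
      unfolding V by simp
  qed (use Cons.prems(1,2,4,5) in auto)
  then have "sub_le S (y \<cdot> u) n"
    using sub_le_inverse_image[OF p n z(1)] eq by simp
  then show ?case by (rule sub_le_cover[OF n y u(2,1)])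
qed

text \<open>\<open>Exs\<close> quantifies along an unspecified enumeration of \<open>V - U\<close>;
  the elimination rule for lists holds for every such enumeration.\<close>

lemma sub_le_Exs:
  assumes "U \<subseteq> V" "finite V" "V \<subseteq> Vars L" "in_context L V \<phi>"
    and "y \<in> hom S t (ctx I U)" "n \<in> Sub S (ctx I U)"
    and "sub_le S y (fm_sub S L I U (Exs (V - U) \<phi>))"
    and "\<And>s w. w \<in> hom S s (ctx I V) \<Longrightarrow> sub_le S w (fm_sub S L I V \<phi>)
           \<Longrightarrow> sub_le S (proj S I U V \<cdot> w) n"
  shows "sub_le S y n"
proof -
  define xs where "xs = (SOME xs. distinct xs \<and> set xs = V - U)"
  have "\<exists>xs. distinct xs \<and> set xs = V - U"
    using finite_distinct_list[of "V - U"] assms(2) by auto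
  from someI_ex[OF this] have xs: "distinct xs" "set xs = V - U" by (auto simp: xs_def)
  have V: "U \<union> set xs = V" using xs(2) assms(1) by auto
  have U: "finite U" "set xs \<inter> U = {}" using assms(1,2) finite_subset xs(2) by auto
  show ?thesis
    using sub_le_foldr_Ex[OF xs(1) U(2,1), unfolded V, OF assms(3-6)] assms(7,8)
    unfolding Exs_def xs_def[symmetric] by blast
qed

lemma model_family:
  assumes "finite U" "U \<subseteq> Vars L" "finite (\<Gamma> \<inter> Fm L U)"
  shows model_family_Sub: "model_family S L I \<Gamma> U \<in> Sub S (ctx I U)"
    and sub_le_model_family: "y \<in> hom S t (ctx I U) \<Longrightarrow>
      sub_le S y (model_family S L I \<Gamma> U) \<longleftrightarrow> (\<forall>\<phi> \<in> \<Gamma> \<inter> Fm L U. sub_le S y (fm_sub S L I U \<phi>))"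
proof -
  have *: "fm_sub S L I U ` (\<Gamma> \<inter> Fm L U) \<subseteq> Sub S (ctx I U)"
    using fm_sub_Sub[OF assms(1,2)] by (auto simp: Fm_def)
  note m = meet[OF ctx_Obj[OF assms(1,2)] finite_imageI[OF assms(3)] *, folded model_family_def]
  show "model_family S L I \<Gamma> U \<in> Sub S (ctx I U)" by (rule m(1))
  show "y \<in> hom S t (ctx I U) \<Longrightarrow>
      sub_le S y (model_family S L I \<Gamma> U) \<longleftrightarrow> (\<forall>\<phi> \<in> \<Gamma> \<inter> Fm L U. sub_le S y (fm_sub S L I U \<phi>))"
    using m(2) by simp
qed

text \<open>\<open>\<Gamma>\<close> may be infinite and have no meet, so its truth at
  \<open>y\<close> is expressed formula by formula. \<open>models\<close> supplies a finite subset,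
  whose meet does exist and contains \<open>y\<close>.\<close>

lemma ent_sound:
  assumes "regular_theory L ent" "models S L I X ent" "U \<subseteq> X" "ent U \<Gamma> \<phi>"
    and "y \<in> hom S t (ctx I U)" "\<And>\<psi>. \<psi> \<in> \<Gamma> \<Longrightarrow> sub_le S y (fm_sub S L I U \<psi>)"
  shows "sub_le S y (fm_sub S L I U \<phi>)"
proof -
  have U: "finite U" "U \<subseteq> Vars L" and fm: "\<Gamma> \<subseteq> Fm L U" "\<phi> \<in> Fm L U"
    using regular_theory.sequent[OF assms(1,4)] by auto
  obtain \<Delta> where \<Delta>: "\<Delta> \<subseteq> \<Gamma>" "finite \<Delta>"
    "sub_le S (meet S (ctx I U) (fm_sub S L I U ` \<Delta>)) (fm_sub S L I U \<phi>)"
    using assms(2)[unfolded models_def, rule_format, OF assms(3,4)] by auto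
  have "fm_sub S L I U ` \<Delta> \<subseteq> Sub S (ctx I U)"
    using fm_sub_Sub[OF U] fm(1) \<Delta>(1) by (auto simp: Fm_def)
  note m = meet[OF ctx_Obj[OF U] finite_imageI[OF \<Delta>(2)] this]
  have "sub_le S y (meet S (ctx I U) (fm_sub S L I U ` \<Delta>))"
    unfolding m(2)[OF assms(5)] using assms(6) \<Delta>(1) by blast
  moreover have "fm_sub S L I U \<phi> \<in> Sub S (ctx I U)"
    using fm_sub_Sub[OF U] fm(2) by (simp add: Fm_def)
  ultimately show ?thesis
    using sub_le_trans[OF m(1) _ assms(5) _ \<Delta>(3)] by blast
qed

section \<open>No-signalling subpresheaves\<close>

lemma no_signalling_hom: "no_signalling S I \<C> B \<Longrightarrow> U \<in> \<C> \<Longrightarrow> B U \<in> hom S (src S (B U)) (ctx I U)"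
  by (rule Sub_hom) (simp add: no_signalling_def subpresheaf_def)

text \<open>By \<open>fm_sub_proj\<close>, truth of \<open>\<phi>\<close> on \<open>B V\<close> is
  truth on the composite \<open>B U \<cdot> h\<close>. No-signalling makes \<open>h\<close> a cover,
  so truth also descends to \<open>B U\<close> itself.\<close>

lemma no_signalling_restrict:
  assumes "simplicial_complex X \<C>" "X \<subseteq> Vars L" "no_signalling S I \<C> B"
    and "V \<in> \<C>" "U \<subseteq> V" "in_context L U \<phi>"
  shows "sub_le S (B V) (fm_sub S L I V \<phi>) \<longleftrightarrow> sub_le S (B U) (fm_sub S L I U \<phi>)"
proof -
  have V: "finite V" "V \<subseteq> Vars L" and UC: "U \<in> \<C>"
    using assms(1,2,4,5) unfolding simplicial_complex_def by blast+
  then have U: "finite U" "U \<subseteq> Vars L" using assms(5) finite_subset by auto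
  have B: "B V \<in> Sub S (ctx I V)" "B U \<in> Sub S (ctx I U)"
    using assms(3,4) UC by (auto simp: no_signalling_def subpresheaf_def)
  obtain h where h: "h \<in> hom S (src S (B V)) (src S (B U))" "B U \<cdot> h = proj S I U V \<cdot> B V"
    "regular_epi S h"
    using assms(3-5) unfolding no_signalling_def subpresheaf_def restricts_to_def by metis
  have "sub_le S (B V) (fm_sub S L I V \<phi>) \<longleftrightarrow> sub_le S (B U \<cdot> h) (fm_sub S L I U \<phi>)"
    using fm_sub_proj[OF V assms(5,6) Sub_hom[OF B(1)]] h(2) by simp
  also have "\<dots> \<longleftrightarrow> sub_le S (B U) (fm_sub S L I U \<phi>)"
    using sub_le_cover[OF fm_sub_Sub[OF U assms(6)] Sub_hom[OF B(2)] h(3,1)]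
      sub_le_comp[OF fm_sub_Sub[OF U assms(6)] Sub_hom[OF B(2)] _ h(1)] by blast
  finally show ?thesis .
qed

text \<open>Truth is required in every simplex that is a context of the formula, in the hypothesis
  as in the conclusion. This makes \<open>cut\<close> immediate, since the cut formula may be reused
  in a different context, and leaves the change of context to the rule \<open>local\<close>.\<close>

lemma inchworm_sound:
  assumes X: "simplicial_complex X \<C>" "X \<subseteq> Vars L"
    and ent: "regular_theory L ent" "models S L I X ent"
    and B: "no_signalling S I \<C> B"
  shows "inchworm L ent \<C> \<Gamma> \<phi> \<Longrightarrow>
     (\<And>\<psi> U. \<psi> \<in> \<Gamma> \<Longrightarrow> U \<in> \<C> \<Longrightarrow> \<psi> \<in> Fm L U \<Longrightarrow> sub_le S (B U) (fm_sub S L I U \<psi>)) \<Longrightarrow>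
     V \<in> \<C> \<Longrightarrow> \<phi> \<in> Fm L V \<Longrightarrow> sub_le S (B V) (fm_sub S L I V \<phi>)"
proof (induction arbitrary: V rule: inchworm.induct)
  case (local U \<phi> \<Gamma>)
  have "U \<subseteq> X" using X(1) local.hyps(1) by (auto simp: simplicial_complex_def)
  moreover have "B U \<in> hom S (src S (B U)) (ctx I U)"
    using no_signalling_hom[OF B local.hyps(1)] .
  ultimately have "sub_le S (B U) (fm_sub S L I U \<phi>)"
    using ent_sound[OF ent _ local.hyps(3)] local.prems(1) local.hyps(1) by auto
  \<comment> \<open>\<open>U\<close> and \<open>V\<close> need not be nested, so both are compared
    with \<open>U \<inter> V\<close>.\<close>
  moreover have "in_context L (U \<inter> V) \<phi>"
    using in_context_Int local.hyps(2) local.prems(3) by (auto simp: Fm_def)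
  ultimately show ?case
    using no_signalling_restrict[OF X B, of _ "U \<inter> V" \<phi>] local.hyps(1) local.prems(2) by auto
next
  case (cut \<Gamma> \<phi> \<Delta> \<psi>)
  then show ?case by blast
qed

text \<open>\<open>n\<close> is the image of \<open>M(\<Gamma>)\<^sub>V\<close> in \<open>F\<^sub>U\<close>. Saturation, applied to the conjunction of
  \<open>\<Gamma>\<^sub>V\<close>, says that \<open>M(\<Gamma>)\<^sub>U\<close> is contained in it.\<close>

lemma saturated_no_signalling:
  assumes X: "simplicial_complex X \<C>" "X \<subseteq> Vars L"
    and ent: "regular_theory L ent" "models S L I X ent"
    and fin: "C_finite L \<C> \<Gamma>" and sat: "inchworm_saturated L ent \<C> \<Gamma>"
  shows "no_signalling S I \<C> (model_family S L I \<Gamma>)"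
proof -
  let ?M = "model_family S L I \<Gamma>"
  have ctxt: "finite V \<and> V \<subseteq> Vars L \<and> V \<subseteq> X" if "V \<in> \<C>" for V
    using that X unfolding simplicial_complex_def by blast
  have down: "U \<in> \<C>" if "V \<in> \<C>" "U \<subseteq> V" for U V
    using that X(1) unfolding simplicial_complex_def by blast
  have M: "?M V \<in> Sub S (ctx I V)" if "V \<in> \<C>" for V
    using model_family_Sub ctxt[OF that] fin that by (simp add: C_finite_def)
  have mem: "sub_le S y (?M V) \<longleftrightarrow> (\<forall>\<phi> \<in> \<Gamma> \<inter> Fm L V. sub_le S y (fm_sub S L I V \<phi>))"
    if "V \<in> \<C>" "y \<in> hom S t (ctx I V)" for V y t
    using sub_le_model_family that(2) ctxt[OF that(1)] fin that(1) by (simp add: C_finite_def)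
  have restr: "\<exists>h. restricts_to S I ?M U V h" if VC: "V \<in> \<C>" and UV: "U \<subseteq> V" for U V
  proof -
    have V: "finite V" "V \<subseteq> Vars L" using ctxt[OF VC] by auto
    note MV = Sub_hom[OF M[OF VC]] and UC = down[OF VC UV]
    note pM = comp_hom[OF MV proj_hom[OF V UV]]
    \<comment> \<open>A formula of \<open>\<Gamma>\<close> in context \<open>U\<close> is also in
      context \<open>V\<close>, so it is among the formulas whose meet is
      \<open>?M V\<close>.\<close>
    have "sub_le S (proj S I U V \<cdot> ?M V) (fm_sub S L I U \<phi>)" if \<phi>: "\<phi> \<in> \<Gamma> \<inter> Fm L U" for \<phi>
    proof -
      have "in_context L U \<phi>" "\<phi> \<in> \<Gamma> \<inter> Fm L V"
        using \<phi> in_context_mono[OF _ UV] by (auto simp: Fm_def)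
      then show ?thesis
        using fm_sub_proj[OF V UV _ MV] mem[OF VC MV] sub_le_refl[OF M[OF VC]] by blast
    qed
    then have "sub_le S (proj S I U V \<cdot> ?M V) (?M U)" using mem[OF UC pM] by blast
    then show ?thesis using sub_leE[OF _ pM] unfolding restricts_to_def by metis
  qed
  have "regular_epi S h" if VC: "V \<in> \<C>" and UV: "U \<subseteq> V" and h: "restricts_to S I ?M U V h" for U V h
  proof -
    have V: "finite V" "V \<subseteq> Vars L" "V \<subseteq> X" using ctxt[OF VC] by auto
    note UC = down[OF VC UV]
    have U: "finite U" "U \<subseteq> Vars L" "U \<subseteq> X" using ctxt[OF UC] by auto
    note MV = Sub_hom[OF M[OF VC]] and MU = Sub_hom[OF M[OF UC]]
    have h: "h \<in> hom S (src S (?M V)) (src S (?M U))" "?M U \<cdot> h = proj S I U V \<cdot> ?M V"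
      using h by (auto simp: restricts_to_def)
    obtain n e where n: "n \<in> Sub S (ctx I U)" and e: "e \<in> hom S (src S (?M V)) (src S n)"
      "regular_epi S e" "n \<cdot> e = proj S I U V \<cdot> ?M V"
      using image_factorization[OF comp_hom[OF MV proj_hom[OF V(1,2) UV]]] by metis
    have "finite (\<Gamma> \<inter> Fm L V)" using fin VC by (simp add: C_finite_def)
    then obtain \<phi>s where \<phi>s: "set \<phi>s = \<Gamma> \<inter> Fm L V" using finite_list by metis
    \<comment> \<open>The claim is generalized to all lists from
      \<open>\<Gamma> \<inter> Fm L V\<close>, because the equation for \<open>set \<phi>s\<close>
      does not survive an induction on the list.\<close>
    have "ent V (\<Gamma> \<inter> Fm L V) (foldr And \<psi>s Top)" if "set \<psi>s \<subseteq> \<Gamma> \<inter> Fm L V" for \<psi>s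
      using that
      by (induction \<psi>s)
        (auto intro: regular_theory.Top[OF ent(1) V(1,2)] regular_theory.assumption[OF ent(1) V(1,2)]
          simp: regular_theory.And[OF ent(1)])
    then have conj: "ent V (\<Gamma> \<inter> Fm L V) (foldr And \<phi>s Top)" using \<phi>s by simp
    then have conj_Fm: "foldr And \<phi>s Top \<in> Fm L V"
      using regular_theory.sequent[OF ent(1)] by blast
    with conj have "ent U (\<Gamma> \<inter> Fm L U) (Exs (V - U) (foldr And \<phi>s Top))"
      using sat UV VC unfolding inchworm_saturated_def by blast
    then have ex: "sub_le S (?M U) (fm_sub S L I U (Exs (V - U) (foldr And \<phi>s Top)))"
      using ent_sound[OF ent U(3) _ MU] mem[OF UC MU] sub_le_refl[OF M[OF UC]] by blast
    have "sub_le S (?M U) n"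
    proof (rule sub_le_Exs[OF UV V(1,2) _ MU n ex])
      show "in_context L V (foldr And \<phi>s Top)" using conj_Fm by (simp add: Fm_def)
    next
      fix s w assume w: "w \<in> hom S s (ctx I V)" "sub_le S w (fm_sub S L I V (foldr And \<phi>s Top))"
      then have "sub_le S w (?M V)"
        using mem[OF VC w(1)] sub_le_fm_sub_conj[OF V(1,2) w(1)] \<phi>s by auto
      then obtain k where k: "k \<in> hom S s (src S (?M V))" "?M V \<cdot> k = w"
        using sub_leE[OF _ w(1)] by metis
      have "n \<cdot> (e \<cdot> k) = proj S I U V \<cdot> w"
        using comp_assoc[OF k(1) e(1) Sub_hom[OF n]] comp_assoc[OF k(1) MV proj_hom[OF V(1,2) UV]]
          e(3) k(2) by simp
      then show "sub_le S (proj S I U V \<cdot> w) n"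
        using sub_leI[OF comp_hom[OF w(1) proj_hom[OF V(1,2) UV]] comp_hom[OF k(1) e(1)]] by simp
    qed
    then obtain k where k: "k \<in> hom S (src S (?M U)) (src S n)" "n \<cdot> k = ?M U"
      using sub_leE[OF _ MU] by metis
    \<comment> \<open>\<open>n \<cdot> e\<close> and \<open>?M U \<cdot> h\<close> are the same
      arrow, and \<open>k\<close> embeds \<open>?M U\<close> into the image \<open>n\<close>.
      Cancelling the mono \<open>n\<close> shows that \<open>k \<cdot> h\<close> is the cover
      \<open>e\<close>, so \<open>regular_epi_factor\<close> applies once \<open>k\<close> is known
      to be mono.\<close>
    have "n \<cdot> (k \<cdot> h) = n \<cdot> e"
      using comp_assoc[OF h(1) k(1) Sub_hom[OF n]] k(2) h(2) e(3) by simp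
    then have kh: "k \<cdot> h = e" using Sub_cancel[OF n comp_hom[OF h(1) k(1)] e(1)] by simp
    have "k \<in> Sub S (src S n)"
    proof (rule Sub_intro[OF k(1)])
      fix a f g assume f: "f \<in> hom S a (src S (?M U))" and g: "g \<in> hom S a (src S (?M U))"
        and eq: "k \<cdot> f = k \<cdot> g"
      have "?M U \<cdot> f = ?M U \<cdot> g"
        using comp_assoc[OF f k(1) Sub_hom[OF n]] comp_assoc[OF g k(1) Sub_hom[OF n]] k(2) eq by simp
      then show "f = g" using Sub_cancel[OF M[OF UC] f g] by simp
    qed
    then show ?thesis
      using regular_epi_factor[of k "src S n" h "src S (?M V)"] h(1) e(2) kh homD[OF k(1)] by simp
  qed
  then show ?thesis using M restr by (simp add: no_signalling_def subpresheaf_def)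
qed

end

theorem theorem23:
  fixes S :: "('o, 'a) category"
    and L :: "('s, 'f, 'r, 'v) language"
    and I :: "('s, 'f, 'r, 'v, 'o, 'a) interp"
    and ent :: "'v set \<Rightarrow> ('f, 'r, 'v) fm set \<Rightarrow> ('f, 'r, 'v) fm \<Rightarrow> bool"
    and X :: "'v set" and \<C> :: "'v set set"
    and \<Gamma> \<Delta> :: "('f, 'r, 'v) fm set"
  assumes "simplicial_complex X \<C>"
    and "X \<subseteq> Vars L"
    and "regular_theory L ent"
    and "regular_category S"
    and "regular_interpretation S L I"
    and "models S L I X ent"
    and "\<Gamma> \<subseteq> Fm_of L \<C>"
    and "\<Delta> \<subseteq> Fm_of L \<C>"
    and "C_finite L \<C> \<Delta>"
    and "inchworm_saturated L ent \<C> \<Delta>"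
    and "\<Gamma> \<subseteq> \<Delta>"
    and "\<forall>\<phi> \<in> \<Delta>. inchworm L ent \<C> \<Gamma> \<phi>"
  shows "largest_no_signalling_in S I \<C> (model_family S L I \<Gamma>) (model_family S L I \<Delta>)"
proof -
  interpret regular_category S by fact
  interpret regular_interpretation S L I by fact
  interpret interpreted_category S L I ..
  note X = assms(1,2) and ent = assms(3,6)
  let ?M\<Gamma> = "model_family S L I \<Gamma>" and ?M\<Delta> = "model_family S L I \<Delta>"
  note ns = saturated_no_signalling[OF X ent assms(9,10)]
  have sub: "sub_le S (B U) (?M\<Gamma> U) \<longleftrightarrow> (\<forall>\<phi> \<in> \<Gamma> \<inter> Fm L U. sub_le S (B U) (fm_sub S L I U \<phi>))"
    "sub_le S (B U) (?M\<Delta> U) \<longleftrightarrow> (\<forall>\<phi> \<in> \<Delta> \<inter> Fm L U. sub_le S (B U) (fm_sub S L I U \<phi>))"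
    if "U \<in> \<C>" "no_signalling S I \<C> B" for U B
  proof -
    have U: "finite U" "U \<subseteq> Vars L"
      using that(1) X unfolding simplicial_complex_def by blast+
    have \<Delta>: "finite (\<Delta> \<inter> Fm L U)" using assms(9) that(1) by (simp add: C_finite_def)
    \<comment> \<open>\<open>\<Gamma>\<close> inherits finiteness in each simplex from
      \<open>\<Delta>\<close>, so the meet defining \<open>?M\<Gamma> U\<close> exists.\<close>
    then have \<Gamma>: "finite (\<Gamma> \<inter> Fm L U)" using assms(11) finite_subset[OF Int_mono[OF _ subset_refl]] by blast
    have B: "B U \<in> hom S (src S (B U)) (ctx I U)"
      using no_signalling_hom[OF that(2,1)] .
    show "sub_le S (B U) (?M\<Gamma> U) \<longleftrightarrow> (\<forall>\<phi> \<in> \<Gamma> \<inter> Fm L U. sub_le S (B U) (fm_sub S L I U \<phi>))"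
      "sub_le S (B U) (?M\<Delta> U) \<longleftrightarrow> (\<forall>\<phi> \<in> \<Delta> \<inter> Fm L U. sub_le S (B U) (fm_sub S L I U \<phi>))"
      using sub_le_model_family[OF U \<Gamma> B] sub_le_model_family[OF U \<Delta> B] by auto
  qed
  \<comment> \<open>\<open>?M\<Delta>\<close> is itself no-signalling, so both criteria in
    \<open>sub\<close> apply with \<open>?M\<Delta>\<close> in the place of
    \<open>B\<close>.\<close>
  have "sub_le S (?M\<Delta> U) (?M\<Gamma> U)" if U: "U \<in> \<C>" for U
  proof -
    have "?M\<Delta> U \<in> Sub S (ctx I U)"
      using ns U by (auto simp: no_signalling_def subpresheaf_def)
    then show ?thesis
      using sub[OF U ns] sub_le_refl assms(11) by blast
  qed
  moreover have "sub_le S (B U) (?M\<Delta> U)"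
    if B: "no_signalling S I \<C> B" "family_le S \<C> B ?M\<Gamma>" and U: "U \<in> \<C>" for B U
  proof -
    \<comment> \<open>This is the premise of \<open>inchworm_sound\<close> for
      \<open>\<Gamma>\<close>; the derivability of each formula of \<open>\<Delta>\<close> then
      carries truth on \<open>B\<close> over to \<open>\<Delta>\<close>.\<close>
    have "sub_le S (B V) (fm_sub S L I V \<psi>)" if "\<psi> \<in> \<Gamma>" "V \<in> \<C>" "\<psi> \<in> Fm L V" for \<psi> V
      using B(2) sub(1)[OF that(2) B(1)] that by (auto simp: family_le_def)
    then show ?thesis
      using inchworm_sound[OF X ent B(1)] assms(12) U sub(2)[OF U B(1)] by blast
  qed
  ultimately show ?thesis
    using ns by (auto simp: largest_no_signalling_in_def family_le_def)
qed

end
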